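(* Let $a\ge2$ and $b\ge1$ be integers, consider the fence $\breve F(a,b,a)$, and define $$g=\gcd(a,b),\quad \bar a=a/g,\quad \bar b=b/g,\quad \ell=\operatorname{lcm}(a,b).$$ Let $m$ be the smallest positive integer such that $$m\bar a=q\bar b+1$$ for some positive integer $q$ (such $m$ exists since $\bar a,\bar b$ are relatively prime), and let $q$ be the corresponding integer. Then the orbits of rowmotion on $\breve F(a,b,a)$ can be partitioned by length into three sets $\mathcal S,\mathcal M,\mathcal L$ having the following properties. (a) We have $$\#\mathcal S=\bar a(g-1)^2,\quad \#\mathcal M=q,\quad \#\mathcal L=\bar a-q,$$ and $$\#\mathcal O=\begin{cases}\ell&\text{if }\mathcal O\in\mathcal S,\\ a(2b-2\bar b+m)+g&\text{if }\mathcal O\in\mathcal M,\\ a(2b-\bar b+m)+g&\text{if }\mathcal O\in\mathcal L.\end{cases}$$ (b) For rowmotion on antichains, $\chi$ is homometric. (c) For rowmotion on ideals, $\hat\chi$ is $n/2$-mesic where $n=\#\breve F(a,b,a)=2a+b-1$.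
   Context: The fence $\breve F(a,b,a)$ is the poset on $x_1,\dots,x_{2a+b-1}$ with covering relations $x_1\lhd\cdots\lhd x_a\rhd x_{a+1}\rhd\cdots\rhd x_{a+b}\lhd x_{a+b+1}\lhd\cdots\lhd x_{2a+b-1}$. For a finite poset $P$, rowmotion on antichains is the bijection $\rho$ on the set of antichains sending $A$ to the set of minimal elements of $P\setminus I$, where $I$ is the (lower order) ideal generated by $A$. Rowmotion on ideals is the bijection $\hat\rho$ on the set of ideals sending $I$ to the ideal generated by the minimal elements of $P\setminus I$. Orbits are those of the cyclic groups generated by these maps; $A\mapsto$ (ideal generated by $A$) gives a size-preserving bijection between orbits of $\rho$ and of $\hat\rho$. The length of an orbit $\mathcal O$ is its size $\#\mathcal O$. The statistics are $\chi(A)=\#A$ on antichains and $\hat\chi(I)=\#I$ on ideals, and for a statistic $\mathrm{st}$, $\mathrm{st}(\mathcal O)=\sum_{y\in\mathcal O}\mathrm{st}(y)$. A statistic is $d$-mesic if $\mathrm{st}(\mathcal O)/\#\mathcal O=d$ for every orbit $\mathcal O$; it is homometric if $\#\mathcal O_1=\#\mathcal O_2$ implies $\mathrm{st}(\mathcal O_1)=\mathrm{st}(\mathcal O_2)$ for all orbits $\mathcal O_1,\mathcal O_2$. *)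

theory Defs
  imports Complex_Main "HOL-Combinatorics.Orbits"
begin

text \<open>A poset is given by its set of elements \<open>P\<close> and an order relation \<open>r\<close> on it,
  i.e. \<open>partial_order_on P r\<close>; \<open>(x, y) \<in> r\<close> means \<open>x \<le> y\<close>.\<close>

definition antichains :: "'a set \<Rightarrow> 'a rel \<Rightarrow> 'a set set" where
  "antichains P r = {A. A \<subseteq> P \<and> (\<forall>x\<in>A. \<forall>y\<in>A. (x, y) \<in> r \<longrightarrow> x = y)}"

definition ideals :: "'a set \<Rightarrow> 'a rel \<Rightarrow> 'a set set" where
  "ideals P r = {I. I \<subseteq> P \<and> (\<forall>y\<in>I. \<forall>x\<in>P. (x, y) \<in> r \<longrightarrow> x \<in> I)}"

definition ideal_generated :: "'a set \<Rightarrow> 'a rel \<Rightarrow> 'a set \<Rightarrow> 'a set" where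
  "ideal_generated P r A = {x \<in> P. \<exists>y\<in>A. (x, y) \<in> r}"

definition minimal_elements :: "'a rel \<Rightarrow> 'a set \<Rightarrow> 'a set" where
  "minimal_elements r X = {x \<in> X. \<forall>y\<in>X. (y, x) \<in> r \<longrightarrow> y = x}"

definition antichain_rowmotion :: "'a set \<Rightarrow> 'a rel \<Rightarrow> 'a set \<Rightarrow> 'a set" where
  "antichain_rowmotion P r A = minimal_elements r (P - ideal_generated P r A)"

definition ideal_rowmotion :: "'a set \<Rightarrow> 'a rel \<Rightarrow> 'a set \<Rightarrow> 'a set" where
  "ideal_rowmotion P r I = ideal_generated P r (minimal_elements r (P - I))"

text \<open>\<open>orbit f x\<close> consists of the \<open>(f ^^ k) x\<close> with \<open>k > 0\<close>. Since both rowmotion maps are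
  bijections of finite sets (\<open>bij_betw_antichain_rowmotion\<close> and \<open>bij_betw_ideal_rowmotion\<close>
  below), these are exactly the orbits of the cyclic groups they generate.\<close>

definition antichain_orbits :: "'a set \<Rightarrow> 'a rel \<Rightarrow> 'a set set set" where
  "antichain_orbits P r = orbit (antichain_rowmotion P r) ` antichains P r"

definition ideal_orbits :: "'a set \<Rightarrow> 'a rel \<Rightarrow> 'a set set set" where
  "ideal_orbits P r = orbit (ideal_rowmotion P r) ` ideals P r"

definition mesic :: "real \<Rightarrow> ('b \<Rightarrow> real) \<Rightarrow> 'b set set \<Rightarrow> bool" where
  "mesic d st Os \<longleftrightarrow> (\<forall>X\<in>Os. (\<Sum>y\<in>X. st y) / real (card X) = d)"

definition homometric :: "('b \<Rightarrow> real) \<Rightarrow> 'b set set \<Rightarrow> bool" where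
  "homometric st Os \<longleftrightarrow>
     (\<forall>X\<in>Os. \<forall>Y\<in>Os. card X = card Y \<longrightarrow> (\<Sum>y\<in>X. st y) = (\<Sum>y\<in>Y. st y))"

text \<open>The fence \<open>F(a, b, a)\<close>, with \<open>x\<^sub>i\<close> encoded as the number \<open>i\<close>. A pair \<open>(i, j)\<close> in
  \<open>fence_covers a b\<close> means that \<open>x\<^sub>i\<close> is covered by \<open>x\<^sub>j\<close>.\<close>

definition fence :: "nat \<Rightarrow> nat \<Rightarrow> nat set" where
  "fence a b = {1..2 * a + b - 1}"

definition fence_covers :: "nat \<Rightarrow> nat \<Rightarrow> nat rel" where
  "fence_covers a b =
     {(i, i + 1) | i. 1 \<le> i \<and> i < a} \<union>
     {(i + 1, i) | i. a \<le> i \<and> i < a + b} \<union>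
     {(i, i + 1) | i. a + b \<le> i \<and> i < 2 * a + b - 1}"

definition fence_order :: "nat \<Rightarrow> nat \<Rightarrow> nat rel" where
  "fence_order a b = Restr ((fence_covers a b)\<^sup>*) (fence a b)"

lemma partial_order_on_fence: "partial_order_on (fence a b) (fence_order a b)"
proof -
  define h :: "nat \<Rightarrow> int" where
    "h i = (if i \<le> a then int i else if i \<le> a + b then 2 * int a - int i
            else int i - 2 * int b)" for i
  have cov: "(x, y) \<in> fence_covers a b \<Longrightarrow> h x < h y" for x y
    by (auto simp: fence_covers_def h_def)
  have "h x < h y" if "(x, y) \<in> (fence_covers a b)\<^sup>+" for x y
    using that by (induction rule: trancl_induct) (auto dest: cov intro: less_trans)
  then have "acyclic (fence_covers a b)"
    unfolding acyclic_def by blast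
  then have "antisym ((fence_covers a b)\<^sup>*)"
    by (rule acyclic_impl_antisym_rtrancl)
  then show ?thesis
    unfolding partial_order_on_def preorder_on_def fence_order_def
    by (auto simp: refl_on_def trans_def antisym_def intro: rtrancl_trans)
qed

context
  fixes P :: "'a set" and r :: "'a rel"
  assumes fin: "finite P" and po: "partial_order_on P r"
begin

private lemma refl: "x \<in> P \<Longrightarrow> (x, x) \<in> r"
  using po by (auto simp: partial_order_on_def preorder_on_def refl_on_def)

private lemma trans: "(x, y) \<in> r \<Longrightarrow> (y, z) \<in> r \<Longrightarrow> (x, z) \<in> r"
  using po by (auto simp: partial_order_on_def preorder_on_def dest: transD)

private lemma antisym: "(x, y) \<in> r \<Longrightarrow> (y, x) \<in> r \<Longrightarrow> x = y"
  using po by (auto simp: partial_order_on_def dest: antisymD)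

private lemma wf_strict: "wf ((r - Id) \<inter> P \<times> P)"
proof (rule finite_acyclic_wf)
  show "finite ((r - Id) \<inter> P \<times> P)" using fin by auto
  have "((r - Id) \<inter> P \<times> P)\<^sup>+ \<subseteq> r - Id"
  proof
    fix p assume "p \<in> ((r - Id) \<inter> P \<times> P)\<^sup>+"
    then show "p \<in> r - Id"
    proof (induction p)
      case (Pair x y)
      then show ?case
        by (induction rule: trancl_induct) (auto intro: trans antisym dest: antisym)
    qed
  qed
  then show "acyclic ((r - Id) \<inter> P \<times> P)" unfolding acyclic_def by auto
qed

private lemma ex_minimal_below:
  assumes "X \<subseteq> P" "x \<in> X"
  shows "\<exists>y\<in>minimal_elements r X. (y, x) \<in> r"
  using assms(2)
proof (induction x rule: wf_induct_rule[OF wf_strict])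
  case (1 x)
  show ?case
  proof (cases "x \<in> minimal_elements r X")
    case True
    then show ?thesis using refl 1 assms by auto
  next
    case False
    then obtain z where "z \<in> X" "(z, x) \<in> r" "z \<noteq> x"
      using 1 by (auto simp: minimal_elements_def)
    then show ?thesis using 1 assms trans by blast
  qed
qed

private lemma ex_maximal_above:
  assumes "X \<subseteq> P" "x \<in> X"
  shows "\<exists>y\<in>minimal_elements (r\<inverse>) X. (x, y) \<in> r"
proof -
  have "wf (((r - Id) \<inter> P \<times> P)\<inverse>)"
    by (rule finite_acyclic_wf_converse[OF _ wf_acyclic[OF wf_strict]]) (use fin in auto)
  from this assms(2) show ?thesis
  proof (induction x rule: wf_induct_rule)
    case (less x)
    show ?case
    proof (cases "x \<in> minimal_elements (r\<inverse>) X")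
      case True
      then show ?thesis using refl less assms by auto
    next
      case False
      then obtain z where "z \<in> X" "(x, z) \<in> r" "z \<noteq> x"
        using less by (auto simp: minimal_elements_def)
      then show ?thesis using less assms trans by blast
    qed
  qed
qed

private lemma bij_betw_ideal_generated:
  "bij_betw (ideal_generated P r) (antichains P r) (ideals P r)"
proof (rule bij_betw_byWitness[where f' = "minimal_elements (r\<inverse>)"])
  show "\<forall>A\<in>antichains P r. minimal_elements (r\<inverse>) (ideal_generated P r A) = A"
  proof
    fix A assume A: "A \<in> antichains P r"
    have "x \<in> A" if x: "x \<in> minimal_elements (r\<inverse>) (ideal_generated P r A)" for x
    proof -
      obtain y where "y \<in> A" "(x, y) \<in> r"
        using x by (auto simp: minimal_elements_def ideal_generated_def)
      moreover have "y \<in> ideal_generated P r A"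
        using \<open>y \<in> A\<close> A refl by (auto simp: ideal_generated_def antichains_def)
      ultimately show ?thesis using x by (auto simp: minimal_elements_def)
    qed
    moreover have "x \<in> minimal_elements (r\<inverse>) (ideal_generated P r A)" if "x \<in> A" for x
    proof -
      have "y = x" if y: "y \<in> ideal_generated P r A" "(x, y) \<in> r" for y
      proof -
        obtain z where z: "z \<in> A" "(y, z) \<in> r" using y by (auto simp: ideal_generated_def)
        then have "x = z" using A \<open>x \<in> A\<close> trans y by (auto simp: antichains_def)
        then show ?thesis using z y antisym by blast
      qed
      moreover have "x \<in> P" "(x, x) \<in> r" using that A refl by (auto simp: antichains_def)
      ultimately show ?thesis using that
        unfolding minimal_elements_def ideal_generated_def by blast
    qed
    ultimately show "minimal_elements (r\<inverse>) (ideal_generated P r A) = A" by blast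
  qed
  show "\<forall>I\<in>ideals P r. ideal_generated P r (minimal_elements (r\<inverse>) I) = I"
  proof
    fix I assume I: "I \<in> ideals P r"
    then have "I \<subseteq> P" by (auto simp: ideals_def)
    then show "ideal_generated P r (minimal_elements (r\<inverse>) I) = I"
      using I ex_maximal_above[of I]
      by (auto simp: ideal_generated_def ideals_def minimal_elements_def)
  qed
  show "ideal_generated P r ` antichains P r \<subseteq> ideals P r"
    by (auto simp: ideal_generated_def ideals_def intro: trans)
  show "minimal_elements (r\<inverse>) ` ideals P r \<subseteq> antichains P r"
    by (auto simp: minimal_elements_def ideals_def antichains_def)
qed

private lemma bij_betw_minimal_complement:
  "bij_betw (\<lambda>I. minimal_elements r (P - I)) (ideals P r) (antichains P r)"
proof (rule bij_betw_byWitness[where f' = "\<lambda>A. {x \<in> P. \<not> (\<exists>y\<in>A. (y, x) \<in> r)}"])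
  show "\<forall>I\<in>ideals P r. {x \<in> P. \<not> (\<exists>y\<in>minimal_elements r (P - I). (y, x) \<in> r)} = I"
  proof
    fix I assume I: "I \<in> ideals P r"
    have "\<exists>y\<in>minimal_elements r (P - I). (y, x) \<in> r" if "x \<in> P - I" for x
      using ex_minimal_below[OF _ that] by blast
    moreover have "minimal_elements r (P - I) \<subseteq> P - I"
      by (auto simp: minimal_elements_def)
    ultimately show "{x \<in> P. \<not> (\<exists>y\<in>minimal_elements r (P - I). (y, x) \<in> r)} = I"
      using I unfolding ideals_def by blast
  qed
  show "\<forall>A\<in>antichains P r.
      minimal_elements r (P - {x \<in> P. \<not> (\<exists>y\<in>A. (y, x) \<in> r)}) = A"
  proof
    fix A assume A: "A \<in> antichains P r"
    have eq: "P - {x \<in> P. \<not> (\<exists>y\<in>A. (y, x) \<in> r)} = {x \<in> P. \<exists>y\<in>A. (y, x) \<in> r}"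
      by auto
    have "x \<in> A" if x: "x \<in> minimal_elements r {x \<in> P. \<exists>y\<in>A. (y, x) \<in> r}" for x
    proof -
      obtain y where y: "y \<in> A" "(y, x) \<in> r" using x by (auto simp: minimal_elements_def)
      then have "y \<in> {x \<in> P. \<exists>y\<in>A. (y, x) \<in> r}"
        using A refl by (auto simp: antichains_def)
      then show ?thesis using x y by (auto simp: minimal_elements_def)
    qed
    moreover have "x \<in> minimal_elements r {x \<in> P. \<exists>y\<in>A. (y, x) \<in> r}" if "x \<in> A" for x
    proof -
      have "y = x" if y: "z \<in> A" "(z, y) \<in> r" "(y, x) \<in> r" for y z
      proof -
        have "z = x" using A \<open>x \<in> A\<close> trans y by (auto simp: antichains_def)
        then show ?thesis using y antisym by blast
      qed
      moreover have "x \<in> P" "(x, x) \<in> r" using that A refl by (auto simp: antichains_def)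
      ultimately show ?thesis using that unfolding minimal_elements_def by blast
    qed
    ultimately show "minimal_elements r (P - {x \<in> P. \<not> (\<exists>y\<in>A. (y, x) \<in> r)}) = A"
      unfolding eq by blast
  qed
  show "(\<lambda>I. minimal_elements r (P - I)) ` ideals P r \<subseteq> antichains P r"
    by (auto simp: minimal_elements_def antichains_def)
  show "(\<lambda>A. {x \<in> P. \<not> (\<exists>y\<in>A. (y, x) \<in> r)}) ` antichains P r \<subseteq> ideals P r"
    by (auto simp: ideals_def intro: trans)
qed

lemma bij_betw_antichain_rowmotion:
  "bij_betw (antichain_rowmotion P r) (antichains P r) (antichains P r)"
  using bij_betw_trans[OF bij_betw_ideal_generated bij_betw_minimal_complement]
  by (simp add: comp_def antichain_rowmotion_def[abs_def])

lemma bij_betw_ideal_rowmotion: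
  "bij_betw (ideal_rowmotion P r) (ideals P r) (ideals P r)"
  using bij_betw_trans[OF bij_betw_minimal_complement bij_betw_ideal_generated]
  by (simp add: comp_def ideal_rowmotion_def[abs_def])

end

end

theory Submission
  imports Defs
begin

text \<open>
  An ideal is recorded by the numbers \<open>i\<close>, \<open>j\<close>, \<open>k\<close> of its elements on the left, middle and right
  segment of the fence. Rowmotion advances \<open>i\<close> and \<open>k\<close> cyclically modulo \<open>a\<close>, while \<open>j\<close> runs from
  \<open>1\<close> to \<open>b\<close>. Looking only at the moments \<open>j = b\<close> gives a map on the torus of pairs \<open>(u, w)\<close>
  modulo \<open>a\<close>: points off the two axes are translated by \<open>(b, b)\<close>, and on the cross formed by the
  axes, which has \<open>2a - 1\<close> points, the translation is preceded by a cyclic shift of the cross.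
  Number the cross from \<open>-(a - 1)\<close> to \<open>a - 1\<close>. The first return map to it is \<open>x \<mapsto> x + 1\<close> followed by
  the reflection \<open>x \<mapsto> -x\<close> of the multiples of \<open>g\<close>; its cycles are the \<open>a'\<close> blocks of numbers
  in \<open>[gc, g(c + 1))\<close> together with their reflections, and the return times add up to the lengths of
  the medium and large orbits. The translation cycles missing the cross are the small orbits.
  The lengths found for one representative per block and per missed cycle sum to the number of ideals,
  so no two representatives share an orbit and no length is a proper multiple of the true one.

  Up to a coboundary, the cardinalities of ideals and antichains are combinations of the number of
  visits to the peak and of absences from the valley; both numbers are \<open>g\<close> on the medium and large
  orbits and \<open>0\<close> on the small ones.
\<close>

section \<open>Orbits covered by periodic points\<close>

lemma orbit_eq_image_funpow:
  assumes "(F ^^ n) x = x" "0 < n"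
  shows "orbit F x = (\<lambda>t. (F ^^ t) x) ` {..<n}"
proof -
  have *: "(F ^^ t) x = (F ^^ (t mod n)) x" for t
    using funpow_mod_eq[OF assms(1)] by simp
  show ?thesis
  proof (intro equalityI subsetI)
    fix y assume "y \<in> orbit F x"
    then obtain t where "y = (F ^^ t) x" by (auto simp: orbit_altdef)
    then show "y \<in> (\<lambda>t. (F ^^ t) x) ` {..<n}" using *[of t] assms(2) by auto
  next
    fix y assume "y \<in> (\<lambda>t. (F ^^ t) x) ` {..<n}"
    then obtain t where "y = (F ^^ (t + n)) x" using assms(1) by (auto simp: funpow_add)
    then show "y \<in> orbit F x" using assms(2) by (auto simp: orbit_altdef)
  qed
qed

lemma orbit_conjugate:
  assumes "\<And>y. y \<in> U \<Longrightarrow> F y \<in> U" "\<And>y. y \<in> U \<Longrightarrow> f (e y) = e (F y)" "x \<in> U"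
  shows "orbit f (e x) = e ` orbit F x"
proof -
  have *: "(F ^^ n) x \<in> U \<and> (f ^^ n) (e x) = e ((F ^^ n) x)" for n
    by (induction n) (use assms in auto)
  then show ?thesis by (auto simp: orbit_altdef)
qed

text \<open>The orbits of the representatives form a set closed under \<open>F\<close> and, by
  injectivity and finiteness, also under preimages, so reachability makes it all of
  \<open>U\<close>. The parametrisation is then a surjection between finite sets of equal size,
  hence injective: each \<open>n j\<close>, assumed only to be some period, is the least
  one.\<close>

lemma bij_betw_periodic_cover:
  assumes fin: "finite U" "finite J"
    and F: "\<And>y. y \<in> U \<Longrightarrow> F y \<in> U" "inj_on F U"
    and c: "\<And>j. j \<in> J \<Longrightarrow> c j \<in> U"
    and period: "\<And>j. j \<in> J \<Longrightarrow> (F ^^ n j) (c j) = c j" "\<And>j. j \<in> J \<Longrightarrow> 0 < n j"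
    and reach: "\<And>y. y \<in> U \<Longrightarrow> \<exists>j\<in>J. \<exists>t. (F ^^ t) y = c j"
    and total: "sum n J = card U"
  shows "bij_betw (\<lambda>(j, t). (F ^^ t) (c j)) (SIGMA j:J. {..<n j}) U"
proof -
  let ?S = "SIGMA j:J. {..<n j}" and ?h = "\<lambda>(j, t). (F ^^ t) (c j)"
  define R where "R = ?h ` ?S"
  have "(F ^^ t) (c j) \<in> U" if "j \<in> J" for j t
    by (induction t) (use c that F in auto)
  then have RU: "R \<subseteq> U" by (auto simp: R_def)
  have orb: "R = (\<Union>j\<in>J. orbit F (c j))"
  proof -
    have "orbit F (c j) = (\<lambda>t. (F ^^ t) (c j)) ` {..<n j}" if "j \<in> J" for j
      using period[OF that] by (rule orbit_eq_image_funpow)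
    then show ?thesis by (force simp: R_def image_iff)
  qed
  have "F ` R \<subseteq> R" unfolding orb by (auto intro: orbit.step)
  moreover have "finite R" "inj_on F R" using RU fin F inj_on_subset finite_subset by blast+
  ultimately have FR: "F ` R = R" by (simp add: endo_inj_surj)
  have preimage: "y \<in> R" if "y \<in> U" "F y \<in> R" for y
    using that FR RU F(2) by (metis (no_types, lifting) imageE inj_onD subsetD)
  have reached: "y \<in> R" if "(F ^^ t) y \<in> R" "y \<in> U" for y t
    using that by (induction t arbitrary: y) (auto simp: funpow_Suc_right simp del: funpow.simps(2) intro: preimage F)
  have rep: "c j \<in> R" if "j \<in> J" for j
    using period[OF that] that by (auto simp: R_def intro!: image_eqI[of _ _ "(j, 0)"])
  have "U \<subseteq> R"
  proof
    fix y assume y: "y \<in> U"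
    then obtain j t where "j \<in> J" "(F ^^ t) y = c j" using reach by blast
    then show "y \<in> R" using reached[of t y] rep[of j] y by simp
  qed
  then have im: "?h ` ?S = U" using RU by (simp add: R_def)
  moreover have "inj_on ?h ?S"
    by (rule eq_card_imp_inj_on) (use im fin total in \<open>auto simp: card_SigmaI\<close>)
  ultimately show ?thesis by (simp add: bij_betw_def)
qed

text \<open>Injectivity in the first component separates the orbits of distinct representatives;
  injectivity in the second turns a sum over an orbit into a sum over one period.\<close>

lemma orbits_periodic_cover:
  fixes F :: "'a \<Rightarrow> 'a" and n :: "'j \<Rightarrow> nat"
  assumes bij: "bij_betw (\<lambda>(j, t). (F ^^ t) (c j)) (SIGMA j:J. {..<n j}) U"
    and period: "\<And>j. j \<in> J \<Longrightarrow> (F ^^ n j) (c j) = c j" "\<And>j. j \<in> J \<Longrightarrow> 0 < n j"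
  shows "orbit F ` U = (\<lambda>j. orbit F (c j)) ` J"
    and "inj_on (\<lambda>j. orbit F (c j)) J"
    and "\<And>(h :: 'a \<Rightarrow> 'c::comm_monoid_add) j. j \<in> J \<Longrightarrow> sum h (orbit F (c j)) = (\<Sum>t<n j. h ((F ^^ t) (c j)))"
proof -
  let ?h = "\<lambda>(j, t). (F ^^ t) (c j)" and ?S = "SIGMA j:J. {..<n j}"
  have inj: "inj_on ?h ?S" and im: "?h ` ?S = U" using bij by (auto simp: bij_betw_def)
  have orb: "orbit F (c j) = (\<lambda>t. (F ^^ t) (c j)) ` {..<n j}" if "j \<in> J" for j
    using period[OF that] by (rule orbit_eq_image_funpow)
  have same: "orbit F ((F ^^ t) (c j)) = orbit F (c j)" if "j \<in> J" "t < n j" for j t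
  proof -
    have "(F ^^ t) (c j) \<in> orbit F (c j)" unfolding orb[OF that(1)] using that(2) by blast
    moreover have "(F ^^ (n j - t)) ((F ^^ t) (c j)) = (F ^^ (n j - t + t)) (c j)" by (simp add: funpow_add)
    then have "(F ^^ (n j - t)) ((F ^^ t) (c j)) = c j" using period(1)[OF that(1)] that(2) by simp
    then have "c j \<in> orbit F ((F ^^ t) (c j))" unfolding orbit_altdef using that(2)
      by (intro CollectI exI[of _ "n j - t"] conjI) simp_all
    ultimately show ?thesis by (blast intro: orbit_trans)
  qed
  show "orbit F ` U = (\<lambda>j. orbit F (c j)) ` J"
  proof (intro equalityI subsetI)
    fix X assume "X \<in> orbit F ` U"
    then obtain j t where "j \<in> J" "t < n j" "X = orbit F ((F ^^ t) (c j))" unfolding im[symmetric] by auto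
    then show "X \<in> (\<lambda>j. orbit F (c j)) ` J" using same by auto
  next
    fix X assume "X \<in> (\<lambda>j. orbit F (c j)) ` J"
    then obtain j where j: "j \<in> J" "X = orbit F (c j)" by auto
    then have "?h (j, 0) \<in> U" unfolding im[symmetric] using period(2)[OF j(1)] by (intro imageI) auto
    then show "X \<in> orbit F ` U" using j by auto
  qed
  show "inj_on (\<lambda>j. orbit F (c j)) J"
  proof (rule inj_onI)
    fix i j assume ij: "i \<in> J" "j \<in> J" "orbit F (c i) = orbit F (c j)"
    have "(F ^^ 0) (c i) \<in> orbit F (c i)" unfolding orb[OF ij(1)] using period(2)[OF ij(1)] by (intro imageI) simp
    then obtain t where "t < n j" "?h (i, 0) = ?h (j, t)" using ij(3) orb[OF ij(2)] by auto
    then show "i = j" using inj_onD[OF inj, of "(i, 0)" "(j, t)"] ij period(2)[OF ij(1)] by auto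
  qed
  show "sum h (orbit F (c j)) = (\<Sum>t<n j. h ((F ^^ t) (c j)))" if j: "j \<in> J" for h :: "'a \<Rightarrow> 'c" and j
  proof -
    have "inj_on (\<lambda>t. (F ^^ t) (c j)) {..<n j}"
      using inj j by (auto simp: inj_on_def)
    then show ?thesis unfolding orb[OF j] by (simp add: sum.reindex)
  qed
qed

section \<open>Ideals and antichains of the fence as triples\<close>

text \<open>An ascending path of covers never changes segment: with \<open>1 \<le> b\<close> the
  peak \<open>a\<close> can only be its last point and the valley \<open>a + b\<close> only its
  first.\<close>

lemma fence_order_iff:
  assumes "1 \<le> b"
  shows "(x, y) \<in> fence_order a b \<longleftrightarrow> x \<in> fence a b \<and> y \<in> fence a b \<and>
     (x \<le> y \<and> y \<le> a \<or> a \<le> y \<and> y \<le> x \<and> x \<le> a + b \<or> a + b \<le> x \<and> x \<le> y)"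
  (is "_ \<longleftrightarrow> _ \<and> _ \<and> ?le x y")
proof -
  have zigzag: "1 \<le> x \<and> ?le x y \<or> x = y" if "(x, y) \<in> (fence_covers a b)\<^sup>*"
    using that
  proof (induction rule: rtrancl_induct)
    case (step y z)
    then show ?case using assms by (auto simp: fence_covers_def)
  qed simp
  have up: "(x, x + d) \<in> (fence_covers a b)\<^sup>*" if "1 \<le> x" "x + d \<le> a" for d
    using that by (induction d) (auto simp: fence_covers_def intro: rtrancl_into_rtrancl)
  have up': "(x, x + d) \<in> (fence_covers a b)\<^sup>*" if "a + b \<le> x" "x + d \<le> 2 * a + b - 1" for d
    using that by (induction d) (auto simp: fence_covers_def intro: rtrancl_into_rtrancl)
  have down: "(y + d, y) \<in> (fence_covers a b)\<^sup>*" if "a \<le> y" "y + d \<le> a + b" for d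
    using that by (induction d) (auto simp: fence_covers_def intro: converse_rtrancl_into_rtrancl)
  have path: "(x, y) \<in> (fence_covers a b)\<^sup>*"
    if le: "?le x y" and bounds: "1 \<le> x" "y \<le> 2 * a + b - 1"
    using le
  proof (elim disjE conjE)
    assume "x \<le> y" "y \<le> a"
    then show ?thesis using up[of "y - x"] bounds by simp
  next
    assume "a \<le> y" "y \<le> x" "x \<le> a + b"
    then show ?thesis using down[of "x - y"] by simp
  next
    assume "a + b \<le> x" "x \<le> y"
    then show ?thesis using up'[of "y - x"] bounds by simp
  qed
  show ?thesis
  proof
    assume "(x, y) \<in> fence_order a b"
    then have "x \<in> fence a b" "y \<in> fence a b" "(x, y) \<in> (fence_covers a b)\<^sup>*"
      by (simp_all add: fence_order_def)
    moreover from zigzag[OF this(3)] have "?le x y" by linarith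
    ultimately show "x \<in> fence a b \<and> y \<in> fence a b \<and> ?le x y" by blast
  next
    assume "x \<in> fence a b \<and> y \<in> fence a b \<and> ?le x y"
    then show "(x, y) \<in> fence_order a b"
      using path by (simp add: fence_order_def fence_def)
  qed
qed

text \<open>This is what turns an ideal into three counts: it is applied to each monotone segment,
  read upwards from its lowest element.\<close>

lemma initial_segment:
  fixes n :: nat
  assumes "\<And>x y. Q y \<Longrightarrow> x \<le> y \<Longrightarrow> y < n \<Longrightarrow> Q x"
  shows "\<exists>k\<le>n. \<forall>x<n. Q x \<longleftrightarrow> x < k"
  using assms
proof (induction n)
  case (Suc n)
  show ?case
  proof (cases "Q n")
    case True
    then have "Q x \<longleftrightarrow> x < Suc n" if "x < Suc n" for x
      using Suc.prems[of n x] that by simp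
    then show ?thesis by blast
  next
    case False
    have "\<exists>k\<le>n. \<forall>x<n. Q x \<longleftrightarrow> x < k"
      using Suc.IH Suc.prems by (metis less_Suc_eq)
    then obtain k where "k \<le> n" "\<forall>x<n. Q x \<longleftrightarrow> x < k" by blast
    then show ?thesis using False by (intro exI[of _ k]) (auto simp: less_Suc_eq)
  qed
qed simp

locale fence_parameters =
  fixes a b :: nat
  assumes a: "2 \<le> a" and b: "1 \<le> b"
begin

text \<open>The peak is counted in both \<open>i\<close> and \<open>j\<close>, the valley in both
  \<open>j\<close> and \<open>k\<close>. The three pieces are the ideals without the valley, those
  with the valley but not the peak, and those with the peak.\<close>

definition states :: "(nat \<times> nat \<times> nat) set" where
  "states = {..<a} \<times> {0} \<times> {0} \<union> {..<a} \<times> {1..b} \<times> {1..a} \<union> {a} \<times> {b + 1} \<times> {1..a}"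

fun ideal_of :: "nat \<times> nat \<times> nat \<Rightarrow> nat set" where
  "ideal_of (i, j, k) = {1..i} \<union> {Suc (a + b) - j..a + b} \<union> {a + b..<a + b + k}"

text \<open>The peak is minimal in the complement only when both elements that it covers belong to
  the ideal. The right segment offers its next element only once the valley, which lies below it, is
  present.\<close>

fun frontier :: "nat \<times> nat \<times> nat \<Rightarrow> nat set" where
  "frontier (i, j, k) = {x. x = i + 1 \<and> x < a} \<union> {x. x = a \<and> i + 1 = a \<and> j = b} \<union>
     {x. x = a + b - j \<and> j < b} \<union> {x. x = a + b + k \<and> 0 < k \<and> k < a}"

text \<open>A segment that cannot grow is lost except for what lies below elements generated
  elsewhere: the left count falls to \<open>0\<close>, whereas the right one falls only to
  \<open>1\<close> when the middle segment keeps the valley.\<close>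

fun step :: "nat \<times> nat \<times> nat \<Rightarrow> nat \<times> nat \<times> nat" where
  "step (i, j, k) =
    (if j = 0 then (if i + 1 < a then i + 1 else 0, 1, 1)
     else if j < b then (if i + 1 < a then i + 1 else 0, j + 1, if k < a then k + 1 else 1)
     else if j = b then
       if i + 1 < a then if k < a then (i + 1, 1, k + 1) else (i + 1, 0, 0)
       else (a, b + 1, if k < a then k + 1 else 1)
     else if k < a then (0, 1, k + 1) else (0, 0, 0))"

lemma states_cases [consumes 1, case_names bottom middle top]:
  assumes "s \<in> states"
  obtains i where "s = (i, 0, 0)" "i < a"
  | i j k where "s = (i, j, k)" "i < a" "1 \<le> j" "j \<le> b" "1 \<le> k" "k \<le> a"
  | k where "s = (a, b + 1, k)" "1 \<le> k" "k \<le> a"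
  using assms unfolding states_def by auto

lemma states_iff:
  "(i, j, k) \<in> states \<longleftrightarrow> i < a \<and> j = 0 \<and> k = 0 \<or> i < a \<and> 1 \<le> j \<and> j \<le> b \<and> 1 \<le> k \<and> k \<le> a \<or>
     i = a \<and> j = b + 1 \<and> 1 \<le> k \<and> k \<le> a"
  by (auto simp: states_def)

lemma finite_states: "finite states"
  by (simp add: states_def)

lemma card_states: "card states = a ^ 2 * b + 2 * a"
  unfolding states_def
  by (subst card_Un_disjoint; (subst card_Un_disjoint)?)
     (auto simp: card_cartesian_product power2_eq_square)

lemma step_in_states: "s \<in> states \<Longrightarrow> step s \<in> states"
  using a b by (cases s) (auto simp: states_iff)

text \<open>Each case compares a minimal missing element with the lowest missing element of its own
  segment, and minimality makes the two equal. The peak lies on two segments and so gives two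
  equations.\<close>

lemma minimal_complement_ideal_of:
  assumes "s \<in> states"
  shows "minimal_elements (fence_order a b) (fence a b - ideal_of s) = frontier s"
proof -
  obtain i j k where s: "s = (i, j, k)" by (cases s)
  have le: "(x, y) \<in> fence_order a b \<longleftrightarrow> 1 \<le> x \<and> x \<le> 2 * a + b - 1 \<and> 1 \<le> y \<and> y \<le> 2 * a + b - 1 \<and>
     (x \<le> y \<and> y \<le> a \<or> a \<le> y \<and> y \<le> x \<and> x \<le> a + b \<or> a + b \<le> x \<and> x \<le> y)" for x y
    using fence_order_iff[OF b] by (auto simp: fence_def)
  have st: "i \<le> a \<and> j \<le> b + 1 \<and> k \<le> a \<and> (i = a \<longleftrightarrow> j = b + 1) \<and> (j = 0 \<longleftrightarrow> k = 0)"
    using assms by (auto simp: s states_def)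
  have mem: "x \<in> fence a b - ideal_of s \<longleftrightarrow> 1 \<le> x \<and> x \<le> 2 * a + b - 1 \<and> i < x \<and>
    (a + b < x \<or> x + j \<le> a + b) \<and> (x < a + b \<or> a + b + k \<le> x)" for x
    by (auto simp: s fence_def)
  show ?thesis
  proof (intro set_eqI iffI)
    fix x assume "x \<in> minimal_elements (fence_order a b) (fence a b - ideal_of s)"
    then have x: "x \<in> fence a b - ideal_of s"
      and min: "y \<in> fence a b - ideal_of s \<Longrightarrow> (y, x) \<in> fence_order a b \<Longrightarrow> y = x" for y
      by (auto simp: minimal_elements_def)
    note x = x[unfolded mem] and min = min[unfolded mem le]
    consider "x < a" | "x = a" | "a < x" "x \<le> a + b" | "a + b < x" by linarith
    then show "x \<in> frontier s"
    proof cases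
      case 1
      then have "i + 1 = x" using x st by (intro min) auto
      then show ?thesis using 1 by (simp add: s)
    next
      case 2
      then have "i < a" "j \<le> b" using x st by auto
      then have "i + 1 = x" "a + b - j = x"
        using 2 st a b by (intro min; auto)+
      then show ?thesis using 2 \<open>j \<le> b\<close> by (auto simp: s)
    next
      case 3
      then have "j < b" using x by auto
      then have "a + b - j = x" using x 3 st a by (intro min) auto
      then show ?thesis using \<open>j < b\<close> by (simp add: s)
    next
      case 4
      have "k \<noteq> 0"
      proof
        assume "k = 0"
        then have "a + b = x" using x 4 st a by (intro min) auto
        then show False using 4 by simp
      qed
      moreover from this have "a + b + k = x" using x 4 st a by (intro min) auto
      ultimately show ?thesis using x by (auto simp: s)
    qed
  next
    fix x assume x: "x \<in> frontier s"
    show "x \<in> minimal_elements (fence_order a b) (fence a b - ideal_of s)"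
    proof -
      have "x = i + 1 \<and> x < a \<or> x = a \<and> i + 1 = a \<and> j = b \<or> x = a + b - j \<and> j < b \<or>
        x = a + b + k \<and> 0 < k \<and> k < a"
        using x by (simp add: s)
      then show ?thesis
        unfolding minimal_elements_def mem le mem_Collect_eq Ball_def
        using st a b by (elim disjE conjE) auto
    qed
  qed
qed

lemma ideal_generated_frontier:
  assumes "s \<in> states"
  shows "ideal_generated (fence a b) (fence_order a b) (frontier s) = ideal_of (step s)"
proof -
  obtain i j k where s: "s = (i, j, k)" by (cases s)
  have st: "i < a \<and> j = 0 \<and> k = 0 \<or> i < a \<and> 1 \<le> j \<and> j \<le> b \<and> 1 \<le> k \<and> k \<le> a \<or>
     i = a \<and> j = b + 1 \<and> 1 \<le> k \<and> k \<le> a"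
    using assms by (simp add: s states_iff)
  define below where "below y = {x \<in> fence a b. (x, y) \<in> fence_order a b}" for y
  have below: "below y = (if y < a then {1..y} else if y = a then {1..a + b}
      else if y \<le> a + b then {y..a + b} else {a + b..y})" if "1 \<le> y" "y < 2 * a + b" for y
    unfolding below_def fence_order_iff[OF b] using that a b by (auto simp: fence_def)
  have gen: "ideal_generated (fence a b) (fence_order a b) (frontier s) = (\<Union>y\<in>frontier s. below y)"
    by (auto simp: ideal_generated_def below_def)
  have frontier: "frontier s = (if i + 1 < a then {i + 1} else {}) \<union> (if i + 1 = a \<and> j = b then {a} else {}) \<union>
     (if j < b then {a + b - j} else {}) \<union> (if 0 < k \<and> k < a then {a + b + k} else {})"
    by (auto simp: s)
  have "(\<Union>y\<in>frontier s. below y) = (if i + 1 < a then {1..i + 1} else {}) \<union>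
     (if i + 1 = a \<and> j = b then {1..a + b} else {}) \<union>
     (if j < b then {a + b - j..a + b} else {}) \<union> (if 0 < k \<and> k < a then {a + b..a + b + k} else {})"
    unfolding frontier UN_Un using a b st by (intro arg_cong2[where f = union]) (simp_all add: below)
  also have "\<dots> = ideal_of (step s)"
    unfolding set_eq_iff using st a b by (auto simp: s)
  finally show ?thesis unfolding gen .
qed

lemma inj_on_ideal_of: "inj_on ideal_of states"
proof (rule inj_on_inverseI)
  fix s assume s: "s \<in> states"
  obtain i j k where [simp]: "s = (i, j, k)" by (cases s)
  have "ideal_of s \<inter> {1..a} = {1..i}" "ideal_of s \<inter> {a..a + b} = {Suc (a + b) - j..a + b}"
    "ideal_of s \<inter> {a + b..} = {a + b..<a + b + k}" and j: "j \<le> b + 1"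
    using s a b by (auto simp: states_iff)
  then show "(\<lambda>I. (card (I \<inter> {1..a}), card (I \<inter> {a..a + b}), card (I \<inter> {a + b..}))) (ideal_of s) = s"
    using j by (simp del: ideal_of.simps)
qed

lemma ideal_of_states: "ideal_of ` states = ideals (fence a b) (fence_order a b)"
proof (intro equalityI subsetI)
  fix I assume "I \<in> ideal_of ` states"
  then obtain i j k where I: "I = ideal_of (i, j, k)" and s: "(i, j, k) \<in> states" by auto
  have mem: "x \<in> I \<longleftrightarrow> 1 \<le> x \<and> x \<le> i \<or> a + b < x + j \<and> x \<le> a + b \<or> a + b \<le> x \<and> x < a + b + k" for x
    by (auto simp: I)
  have "I \<subseteq> fence a b"
    unfolding subset_iff mem using s a b by (auto simp: fence_def states_iff)
  moreover have "x \<in> I" if "y \<in> I" "(x, y) \<in> fence_order a b" for x y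
    using that s a b unfolding mem fence_order_iff[OF b] by (auto simp: fence_def states_iff)
  ultimately show "I \<in> ideals (fence a b) (fence_order a b)" by (auto simp: ideals_def)
next
  fix I assume I: "I \<in> ideals (fence a b) (fence_order a b)"
  then have sub: "x \<in> I \<Longrightarrow> 1 \<le> x \<and> x < 2 * a + b" for x
    by (force simp: ideals_def fence_def)
  have down: "x \<in> I" if "y \<in> I" "1 \<le> x"
    "x \<le> y \<and> y \<le> a \<or> a \<le> y \<and> y \<le> x \<and> x \<le> a + b \<or> a + b \<le> x \<and> x \<le> y" for x y
  proof -
    have "x \<in> fence a b" "y \<in> fence a b" using that sub[of y] a by (auto simp: fence_def)
    then show ?thesis using I that by (auto simp: ideals_def fence_order_iff[OF b])
  qed
  have "\<exists>i\<le>a. \<forall>x<a. x + 1 \<in> I \<longleftrightarrow> x < i"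
    by (rule initial_segment) (use down in auto)
  then obtain i where i: "i \<le> a" "\<And>x. x < a \<Longrightarrow> x + 1 \<in> I \<longleftrightarrow> x < i" by blast
  have "\<exists>j\<le>b + 1. \<forall>x<b + 1. a + b - x \<in> I \<longleftrightarrow> x < j"
    by (rule initial_segment) (erule down; use a in auto)
  then obtain j where j: "j \<le> b + 1" "\<And>x. x < b + 1 \<Longrightarrow> a + b - x \<in> I \<longleftrightarrow> x < j" by blast
  have "\<exists>k\<le>a. \<forall>x<a. a + b + x \<in> I \<longleftrightarrow> x < k"
    by (rule initial_segment) (use down a in auto)
  then obtain k where k: "k \<le> a" "\<And>x. x < a \<Longrightarrow> a + b + x \<in> I \<longleftrightarrow> x < k" by blast
  \<comment> \<open>The peak is seen by both the left and the middle count, the valley by both the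
    middle and the right one; these coincidences are the constraints in
    \<open>states\<close>.\<close>
  have ij: "i = a \<longleftrightarrow> j = b + 1" using i(1) i(2)[of "a - 1"] j(1) j(2)[of b] a by auto
  have jk: "j = 0 \<longleftrightarrow> k = 0" using j(2)[of 0] k(2)[of 0] a by auto
  have "(i, j, k) \<in> states" using i(1) j(1) k(1) ij jk by (auto simp: states_iff)
  moreover have "I = ideal_of (i, j, k)"
  proof (rule set_eqI)
    fix x
    consider "x = 0" | "1 \<le> x" "x < a" | "x = a" | "a < x" "x < a + b" | "x = a + b" | "a + b < x" "x < 2 * a + b" | "2 * a + b \<le> x"
      by linarith
    then show "x \<in> I \<longleftrightarrow> x \<in> ideal_of (i, j, k)"
    proof cases
      case 1 then show ?thesis using sub[of x] j a by auto
    next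
      case 2 then show ?thesis using i(2)[of "x - 1"] j by auto
    next
      case 3 then show ?thesis using i(2)[of "x - 1"] i(1) ij j a b by auto
    next
      case 4 then show ?thesis using j(2)[of "a + b - x"] i(1) by auto
    next
      case 5 then show ?thesis using j(2)[of 0] jk i(1) b by auto
    next
      case 6 then show ?thesis using k(2)[of "x - (a + b)"] i(1) by auto
    next
      case 7 then show ?thesis using sub[of x] k(1) i(1) a by auto
    qed
  qed
  ultimately show "I \<in> ideal_of ` states" by blast
qed

lemma ideal_rowmotion_ideal_of:
  "\<forall>s\<in>states. ideal_rowmotion (fence a b) (fence_order a b) (ideal_of s) = ideal_of (step s)"
  by (intro ballI) (simp add: ideal_rowmotion_def minimal_complement_ideal_of ideal_generated_frontier)

lemma antichain_rowmotion_frontier: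
  "\<forall>s\<in>states. antichain_rowmotion (fence a b) (fence_order a b) (frontier s) = frontier (step s)"
  by (intro ballI) (simp add: antichain_rowmotion_def minimal_complement_ideal_of ideal_generated_frontier step_in_states)

lemma bij_betw_step: "bij_betw step states states"
proof -
  have "inj_on step states"
  proof (rule inj_onI)
    fix s t assume st: "s \<in> states" "t \<in> states" "step s = step t"
    have "inj_on (ideal_rowmotion (fence a b) (fence_order a b)) (ideal_of ` states)"
      using bij_betw_ideal_rowmotion[OF _ partial_order_on_fence[of a b]]
      unfolding ideal_of_states by (simp add: bij_betw_def fence_def)
    then have "ideal_of s = ideal_of t"
      using st ideal_rowmotion_ideal_of by (metis imageI inj_onD)
    then show "s = t" using inj_on_ideal_of st by (blast dest: inj_onD)
  qed
  then show ?thesis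
    using endo_inj_surj[OF finite_states] step_in_states by (simp add: bij_betw_def image_subset_iff)
qed

text \<open>Rowmotion is onto the antichains, so every antichain is the set of minimal elements
  outside some ideal, and that ideal is encoded by a state.\<close>

lemma frontier_states: "frontier ` states = antichains (fence a b) (fence_order a b)"
proof -
  let ?A = "antichains (fence a b) (fence_order a b)"
  have "bij_betw (antichain_rowmotion (fence a b) (fence_order a b)) ?A ?A"
    by (rule bij_betw_antichain_rowmotion[OF _ partial_order_on_fence]) (simp add: fence_def)
  then have "?A = antichain_rowmotion (fence a b) (fence_order a b) ` ?A" by (simp add: bij_betw_def)
  also have "\<dots> \<subseteq> frontier ` states"
  proof
    fix B assume "B \<in> antichain_rowmotion (fence a b) (fence_order a b) ` ?A"
    then obtain A where A: "A \<in> ?A" and B: "B = antichain_rowmotion (fence a b) (fence_order a b) A" by blast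
    have "ideal_generated (fence a b) (fence_order a b) A \<in> ideals (fence a b) (fence_order a b)"
      using partial_order_on_fence[of a b]
      by (auto simp: ideal_generated_def ideals_def partial_order_on_def preorder_on_def dest: transD)
    then obtain s where "s \<in> states" "ideal_generated (fence a b) (fence_order a b) A = ideal_of s"
      unfolding ideal_of_states[symmetric] by blast
    then show "B \<in> frontier ` states"
      by (auto simp: B antichain_rowmotion_def minimal_complement_ideal_of simp del: frontier.simps)
  qed
  finally show ?thesis
    by (auto simp del: frontier.simps simp: minimal_complement_ideal_of[symmetric] antichains_def minimal_elements_def)
qed

text \<open>A frontier generates the ideal of the next state, so it determines
  \<open>step s\<close>, and \<open>step\<close> is injective.\<close>

lemma inj_on_frontier: "inj_on frontier states"
proof (rule inj_onI)
  fix s t assume st: "s \<in> states" "t \<in> states" "frontier s = frontier t"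
  then have "ideal_of (step s) = ideal_of (step t)"
    by (metis ideal_generated_frontier)
  then have "step s = step t"
    using inj_on_ideal_of st step_in_states by (blast dest: inj_onD)
  then show "s = t" using bij_betw_step st unfolding bij_betw_def by (blast dest: inj_onD)
qed

section \<open>The torus\<close>

text \<open>\<open>peaks\<close> marks the states whose successor contains the peak \<open>x\<^sub>a\<close>, and \<open>valleys\<close> those that do not
  contain the valley \<open>x\<^bsub>a+b\<^esub>\<close>. In \<open>run s n p v t\<close> the numbers \<open>p\<close> and \<open>v\<close> count such states
  among the first \<open>n\<close>.\<close>

fun peaks :: "nat \<times> nat \<times> nat \<Rightarrow> nat" where
  "peaks (i, j, k) = of_bool (i + 1 = a \<and> j = b)"

fun valleys :: "nat \<times> nat \<times> nat \<Rightarrow> nat" where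
  "valleys (i, j, k) = of_bool (j = 0)"

inductive run :: "nat \<times> nat \<times> nat \<Rightarrow> nat \<Rightarrow> nat \<Rightarrow> nat \<Rightarrow> nat \<times> nat \<times> nat \<Rightarrow> bool" for s where
  run_refl: "run s 0 0 0 s"
| run_step: "run s n p v t \<Longrightarrow> run s (Suc n) (p + peaks t) (v + valleys t) (step t)"

lemma run_trans:
  assumes "run s n p v t" "run t n' p' v' u"
  shows "run s (n + n') (p + p') (v + v') u"
  using assms(2)
proof (induction rule: run.induct)
  case (run_step n' p' v' u)
  then show ?case using run.run_step[of s "n + n'" "p + p'" "v + v'" u] by (simp add: add.assoc)
qed (simp add: assms(1))

lemma run_imp_sums:
  assumes "run s n p v t"
  shows "(step ^^ n) s = t" "(\<Sum>m<n. peaks ((step ^^ m) s)) = p" "(\<Sum>m<n. valleys ((step ^^ m) s)) = v"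
  using assms by (induction rule: run.induct) auto

lemma run_1: "step s = t \<Longrightarrow> run s 1 (peaks s) (valleys s) t"
  using run_step[OF run_refl, of s] by simp

text \<open>For \<open>1 \<le> j \<le> b\<close> the count \<open>k\<close> lies in
  \<open>1..a\<close>, so \<open>w\<close> stands for \<open>k - 1\<close>. Integer arguments modulo
  \<open>a\<close> make both counters advance by plain addition.\<close>

definition position :: "int \<Rightarrow> nat \<Rightarrow> int \<Rightarrow> nat \<times> nat \<times> nat" where
  "position u j w = (nat (u mod int a), j, nat (w mod int a) + 1)"

text \<open>The shift by one makes the axes \<open>u = 0\<close> and \<open>w = 0\<close> the places where a step is exceptional.\<close>

definition torus :: "int \<Rightarrow> int \<Rightarrow> nat \<times> nat \<times> nat" where
  "torus u w = position (u - 1) b (w - 1)"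

lemma nat_mod_less: "nat (u mod int a) < a"
  using a by (simp add: nat_less_iff)

lemma nat_mod_add_1: "nat ((u + 1) mod int a) = (if nat (u mod int a) + 1 < a then nat (u mod int a) + 1 else 0)"
proof -
  define x where "x = nat (u mod int a)"
  have x: "u mod int a = int x" "x < a" using a by (simp_all add: x_def nat_less_iff)
  have "(u + 1) mod int a = int ((x + 1) mod a)"
    using x(1) by (metis mod_add_left_eq of_nat_1 of_nat_add zmod_int)
  also have "(x + 1) mod a = (if x + 1 < a then x + 1 else 0)"
    using x(2) by (cases "x + 1 = a") auto
  finally show ?thesis by (simp add: x_def)
qed

lemma position_cong:
  "u mod int a = u' mod int a \<Longrightarrow> w mod int a = w' mod int a \<Longrightarrow> position u j w = position u' j w'"
  by (simp add: position_def)

lemma torus_cong: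
  "u mod int a = u' mod int a \<Longrightarrow> w mod int a = w' mod int a \<Longrightarrow> torus u w = torus u' w'"
  unfolding torus_def by (intro position_cong) (simp_all add: mod_diff_left_eq[symmetric, of u] mod_diff_left_eq[symmetric, of w] mod_diff_left_eq)

lemma position_in_states: "1 \<le> j \<Longrightarrow> j \<le> b \<Longrightarrow> position u j w \<in> states"
  by (simp add: position_def states_iff Suc_le_eq nat_mod_less)

lemma torus_in_states: "torus u w \<in> states"
  unfolding torus_def using b by (intro position_in_states) auto

lemma step_position: "1 \<le> j \<Longrightarrow> j < b \<Longrightarrow> step (position u j w) = position (u + 1) (j + 1) (w + 1)"
  by (auto simp: position_def nat_mod_add_1)

lemma run_position:
  assumes "1 \<le> j" "j + n \<le> b"
  shows "run (position u j w) n 0 0 (position (u + int n) (j + n) (w + int n))"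
  using assms(2)
proof (induction n)
  case 0 then show ?case by (simp add: run_refl)
next
  case (Suc n)
  have "step (position (u + int n) (j + n) (w + int n)) = position (u + int (Suc n)) (j + Suc n) (w + int (Suc n))"
    using step_position[of "j + n"] assms(1) Suc.prems by (simp add: algebra_simps)
  moreover have "peaks (position (u + int n) (j + n) (w + int n)) = 0" "valleys (position (u + int n) (j + n) (w + int n)) = 0"
    using assms(1) Suc.prems by (simp_all add: position_def)
  ultimately show ?case using run_step[OF Suc.IH] Suc.prems by simp
qed

lemma run_position_torus: "run (position u 1 w) (b - 1) 0 0 (torus (u + b) (w + b))"
  using run_position[of 1 "b - 1" u w] b by (simp add: torus_def of_nat_diff algebra_simps)

lemma mod_eq_0_iff_pred: "u mod int a = 0 \<longleftrightarrow> nat ((u - 1) mod int a) + 1 = a"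
proof -
  have "0 \<le> u mod int a" using a by simp
  then have "u mod int a = 0 \<longleftrightarrow> nat (u mod int a) = 0" by linarith
  also have "\<dots> \<longleftrightarrow> nat ((u - 1) mod int a) + 1 = a"
    using nat_mod_add_1[of "u - 1"] nat_mod_less[of "u - 1"] by (auto split: if_splits)
  finally show ?thesis .
qed

lemma nat_mod_eq_pred: "nat (u mod int a) = (if u mod int a = 0 then 0 else nat ((u - 1) mod int a) + 1)"
  using nat_mod_add_1[of "u - 1"] nat_mod_less[of "u - 1"] mod_eq_0_iff_pred[of u] by auto

section \<open>Passages off and on the axes of the torus\<close>

lemma step_torus_off_axes:
  assumes "u mod int a \<noteq> 0" "w mod int a \<noteq> 0"
  shows "step (torus u w) = position u 1 w" "peaks (torus u w) = 0" "valleys (torus u w) = 0"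
proof -
  define x y where "x = nat ((u - 1) mod int a)" and "y = nat ((w - 1) mod int a)"
  have "x < a" "y < a" "x + 1 \<noteq> a" "y + 1 \<noteq> a"
    using assms mod_eq_0_iff_pred[of u] mod_eq_0_iff_pred[of w] by (auto simp: x_def y_def nat_mod_less)
  moreover have "torus u w = (x, b, y + 1)" "position u 1 w = (x + 1, 1, y + 2)"
    using assms by (simp_all add: torus_def position_def nat_mod_eq_pred[of u] nat_mod_eq_pred[of w] x_def y_def)
  ultimately show "step (torus u w) = position u 1 w" "peaks (torus u w) = 0" "valleys (torus u w) = 0"
    using a b by auto
qed

text \<open>One step resets \<open>j\<close> from \<open>b\<close> to \<open>1\<close> and
  \<open>b - 1\<close> more raise it to \<open>b\<close> again, while both counters advance each
  time.\<close>

lemma run_off_axes: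
  assumes "u mod int a \<noteq> 0" "w mod int a \<noteq> 0"
  shows "run (torus u w) b 0 0 (torus (u + b) (w + b))"
  using run_trans[OF run_1 run_position_torus, of "torus u w" u w] step_torus_off_axes[OF assms] b by simp

text \<open>The right segment is full, so the middle and right ones vanish and the valley is absent
  for one moment. The detour costs one extra step, in which only the left counter gains.\<close>

lemma run_lower_axis:
  assumes "u mod int a \<noteq> 0"
  shows "run (torus u 0) (b + 1) 0 1 (torus (u + 1 + b) b)"
proof -
  define x where "x = nat ((u - 1) mod int a)"
  have x: "x + 1 < a" using assms mod_eq_0_iff_pred[of u] nat_mod_less[of "u - 1"] by (auto simp: x_def)
  have "nat ((0 - 1) mod int a) + 1 = a" using mod_eq_0_iff_pred[of 0] a by simp
  then have t: "torus u 0 = (x, b, a)" by (simp add: torus_def position_def x_def)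
  have "nat (u mod int a) = x + 1" using assms by (simp add: nat_mod_eq_pred[of u] x_def)
  then have p: "position (u + 1) 1 0 = (if x + 2 < a then x + 2 else 0, 1, 1)"
    by (simp add: position_def nat_mod_add_1)
  have "run (x, b, a) 1 0 0 (x + 1, 0, 0)" using x b run_1[of "(x, b, a)"] by simp
  moreover have "run (x + 1, 0, 0) 1 0 1 (position (u + 1) 1 0)" unfolding p using x b run_1[of "(x + 1, 0, 0)"]
    by (cases "x + 2 < a") auto
  ultimately show ?thesis
    using run_trans[OF run_trans run_position_torus, of "torus u 0" 1 0 0 "(x + 1, 0, 0)" 1 0 1 "u + 1" 0] b t
    by (simp add: ac_simps)
qed

text \<open>The left segment is one short of the peak, which appears for one moment and then
  disappears with the left segment. This time only the right counter gains the extra step. The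
  hypothesis excludes that the right segment becomes full at the same moment.\<close>

lemma run_upper_axis:
  assumes "(w + 1) mod int a \<noteq> 0"
  shows "run (torus 0 w) (b + 1) 1 0 (torus b (w + 1 + b))"
proof -
  define y where "y = nat (w mod int a)"
  have y: "y + 1 < a" using assms mod_eq_0_iff_pred[of "w + 1"] nat_mod_less[of w] by (auto simp: y_def)
  have "nat ((0 - 1) mod int a) + 1 = a" using mod_eq_0_iff_pred[of 0] a by simp
  then have t: "torus 0 w = (a - 1, b, if y = 0 then a else y)"
    using nat_mod_add_1[of "w - 1"] nat_mod_less[of "w - 1"]
    by (auto simp: torus_def position_def y_def)
  have p: "position 0 1 (w + 1) = (0, 1, y + 2)"
    using y by (simp add: position_def nat_mod_add_1 y_def)
  have "run (torus 0 w) 1 1 0 (a, b + 1, y + 1)"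
    using y a b run_1[of "torus 0 w"] by (auto simp: t)
  moreover have "run (a, b + 1, y + 1) 1 0 0 (position 0 1 (w + 1))"
    unfolding p using y a b run_1[of "(a, b + 1, y + 1)"] by simp
  ultimately show ?thesis
    using run_trans[OF run_trans run_position_torus, of "torus 0 w" 1 1 0 "(a, b + 1, y + 1)" 1 0 0 0 "w + 1"] b
    by (simp add: ac_simps)
qed

text \<open>The peak and the last element on the right are gained together, so the state reached is
  the full fence; the empty ideal follows it without a return to the torus in between.\<close>

lemma run_corner: "run (torus 0 (int a - 1)) 1 1 0 (a, b + 1, a)"
proof -
  have "nat ((0 - 1) mod int a) + 1 = a" using mod_eq_0_iff_pred[of 0] a by simp
  moreover have "(int a - 1 - 1) mod int a = int a - 2" using a by (subst mod_pos_pos_trivial) auto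
  ultimately have "torus 0 (int a - 1) = (a - 1, b, a - 1)"
    using a by (simp add: torus_def position_def) linarith
  then show ?thesis using a b run_1[of "torus 0 (int a - 1)"] by simp
qed

lemma run_from_corner: "run (a, b + 1, a) (b + 1) 0 1 (torus (1 + b) b)"
proof -
  have "run (a, b + 1, a) 1 0 0 (0, 0, 0)" using a b run_1[of "(a, b + 1, a)"] by simp
  moreover have "position 1 1 0 = (1, 1, 1)" using a by (simp add: position_def)
  then have "run (0, 0, 0) 1 0 1 (position 1 1 0)" using a b run_1[of "(0, 0, 0)"] by simp
  ultimately show ?thesis
    using run_trans[OF run_trans run_position_torus, of "(a, b + 1, a)" 1 0 0 "(0, 0, 0)" 1 0 1 1 0] b by simp
qed

lemma run_free:
  assumes "\<And>s. s < t \<Longrightarrow> (u + int s * b) mod int a \<noteq> 0 \<and> (w + int s * b) mod int a \<noteq> 0"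
  shows "run (torus u w) (t * b) 0 0 (torus (u + int t * b) (w + int t * b))"
  using assms
proof (induction t)
  case 0 then show ?case by (simp add: run_refl)
next
  case (Suc t)
  then have "run (torus u w) (t * b) 0 0 (torus (u + int t * b) (w + int t * b))" by simp
  from run_trans[OF this run_off_axes] Suc.prems[of t] show ?case
    by (simp add: algebra_simps)
qed

section \<open>Reachability of the torus\<close>

definition reaches :: "nat \<times> nat \<times> nat \<Rightarrow> nat \<times> nat \<times> nat \<Rightarrow> bool" where
  "reaches s t \<longleftrightarrow> (\<exists>n. (step ^^ n) s = t)"

lemma run_imp_reaches: "run s n p v t \<Longrightarrow> reaches s t"
  unfolding reaches_def using run_imp_sums(1) by blast

lemma reaches_trans: "reaches s t \<Longrightarrow> reaches t u \<Longrightarrow> reaches s u"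
  unfolding reaches_def by (metis funpow_add comp_apply)

lemma reaches_torus:
  assumes "s \<in> states"
  shows "\<exists>u w. reaches s (torus u w)"
proof -
  have from_middle: "\<exists>u w. reaches s (torus u w)" if "s = (i, j, k)" "i < a" "1 \<le> j" "j \<le> b" "1 \<le> k" "k \<le> a" for i j k s
  proof -
    have "s = position (int i) j (int k - 1)" using that by (simp add: position_def nat_diff_distrib)
    then have "run s (b - j) 0 0 (torus (int i + 1 + int (b - j)) (int k + int (b - j)))"
      using run_position[of j "b - j" "int i" "int k - 1"] that by (simp add: torus_def algebra_simps)
    then show ?thesis using run_imp_reaches by blast
  qed
  have from_bottom: "\<exists>u w. reaches s (torus u w)" if "s = (i, 0, 0)" "i < a" for i s
  proof -
    have "\<exists>u w. reaches (step s) (torus u w)" using that a b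
      by (intro from_middle[of _ "if i + 1 < a then i + 1 else 0" 1 1]) auto
    moreover have "reaches s (step s)" using run_1 run_imp_reaches by blast
    ultimately show ?thesis using reaches_trans by blast
  qed
  show ?thesis
    using assms
  proof (cases rule: states_cases)
    case (bottom i) then show ?thesis using from_bottom by blast
  next
    case (middle i j k) then show ?thesis using from_middle by blast
  next
    case (top k)
    have "\<exists>u w. reaches (step s) (torus u w)"
    proof (cases "k < a")
      case True then show ?thesis using top a b by (intro from_middle[of _ 0 1 "k + 1"]) auto
    next
      case False then show ?thesis using top a b by (intro from_bottom[of _ 0]) auto
    qed
    moreover have "reaches s (step s)" using run_1 run_imp_reaches by blast
    ultimately show ?thesis using reaches_trans by blast
  qed
qed

section \<open>Cardinalities along closed runs\<close>

text \<open>Along a cyclic counter \<open>x = 0, \<dots>, a - 1\<close>, the increments of \<open>x(x - a)\<close> are \<open>2x - (a - 1)\<close>, twice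
  the deviation of \<open>x\<close> from its mean. The last term replaces the indicator of the peak by that of the
  state before it, which is what \<open>peaks\<close> counts.\<close>

fun ideal_potential :: "nat \<times> nat \<times> nat \<Rightarrow> int" where
  "ideal_potential (i, j, k) = int i * (int i - int a)
     + (if j = 0 then 0 else (int j - 1) * (int j - 1 - int b))
     + (if k = 0 then 0 else (int k - 1) * (int k - 1 - int a))
     - (int a + int b) * of_bool (i = a)"

text \<open>In a middle state twice the size \<open>i + j + k - 1\<close> differs from
  \<open>2 * a + b - 1\<close> by twice the summed deviations of the cyclic counters
  \<open>i\<close>, \<open>j - 1\<close>, \<open>k - 1\<close> from their means. Without the valley,
  or with the peak, some counters are missing, which accounts for the last term.\<close>

lemma card_ideal_of:
  assumes "s \<in> states"
  shows "2 * int (card (ideal_of s)) = 2 * int a + int b - 1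
     + (ideal_potential (step s) - ideal_potential s) + (int a + int b) * (int (peaks s) - int (valleys s))"
  using assms
proof (cases rule: states_cases)
  case (bottom i)
  have "ideal_of s = {1..i}" using bottom by auto
  then show ?thesis using bottom a b by (cases "i + 1 = a") (auto simp: algebra_simps)
next
  case (middle i j k)
  have "ideal_of s = {1..i} \<union> {Suc (a + b) - j..<a + b + k}" using middle by auto
  then have card: "card (ideal_of s) = i + (j + k - 1)"
    using middle by (subst \<open>ideal_of s = _\<close>, subst card_Un_disjoint) auto
  have "i + 1 < a \<or> i = a - 1" "j < b \<or> j = b" "k < a \<or> k = a" using middle by linarith+
  then show ?thesis unfolding card using middle a b
    by (elim disjE) (auto simp: of_nat_diff algebra_simps)
next
  case (top k)
  have "ideal_of s = {1..<a + b + k}" using top by auto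
  then have "card (ideal_of s) = a + b + k - 1" by simp
  then show ?thesis using top a b by (cases "k = a") (auto simp: of_nat_diff algebra_simps)
qed

text \<open>A counter of period \<open>a\<close> advances without wrapping for a fraction
  \<open>(a - 1) / a\<close> of the time, and the deviation of that event from its mean is the
  increment of the counter divided by \<open>a\<close>; the factor \<open>a * b\<close> clears
  denominators. The last term gives the top state the left and middle values of the state before
  it.\<close>

fun antichain_potential :: "nat \<times> nat \<times> nat \<Rightarrow> int" where
  "antichain_potential (i, j, k) = int b * (if i < a then int i else 0)
     + int a * (if 1 \<le> j \<and> j \<le> b then int j - 1 else 0)
     + int b * (if k = 0 then 0 else int k - 1)
     + (int b * (int a - 1) + int a * (int b - 1)) * of_bool (i = a)"

text \<open>The cardinality is a sum of four indicators: one is \<open>peaks\<close>, the others say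
  that a segment gains an element other than the peak, the valley being assigned to the middle
  one.\<close>

lemma card_frontier:
  assumes "s \<in> states"
  shows "int a * int b * int (card (frontier s)) = 2 * int b * (int a - 1) + int a * (int b - 1)
     + (antichain_potential (step s) - antichain_potential s)
     + (int a + int b - int a * int b) * (int (peaks s) + int (valleys s))"
proof -
  obtain i j k where s: "s = (i, j, k)" by (cases s)
  have *: "{x. x = c \<and> Q} = (if Q then {c} else {})" for c :: nat and Q by auto
  have st: "i \<le> a" "j \<le> b + 1" "i = a \<longleftrightarrow> j = b + 1" "j = 0 \<longleftrightarrow> k = 0"
    using assms b by (auto simp: s states_iff)
  have fr: "frontier s = {x. x = i + 1 \<and> i + 1 < a} \<union> {x. x = a \<and> i + 1 = a \<and> j = b} \<union>
     {x. x = a + b - j \<and> j < b} \<union> {x. x = a + b + k \<and> 0 < k \<and> k < a}" (is "_ = ?A \<union> ?B \<union> ?C \<union> ?D")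
    by (auto simp: s)
  have "card (frontier s) = card ?A + card ?B + card ?C + card ?D"
    unfolding fr by (subst card_Un_disjoint, simp, simp, force)+ simp
  also have "\<dots> = of_bool (i + 1 < a) + of_bool (i + 1 = a \<and> j = b) + of_bool (j < b) + of_bool (0 < k \<and> k < a)"
    unfolding * by simp
  finally have card: "card (frontier s) = of_bool (i + 1 < a) + of_bool (i + 1 = a \<and> j = b) + of_bool (j < b) + of_bool (0 < k \<and> k < a)" .
  show ?thesis
    using assms
  proof (cases rule: states_cases)
    case (bottom i)
    then show ?thesis unfolding card using a b s by (cases "i + 1 = a") (auto simp: algebra_simps)
  next
    case (middle i j k)
    then have "i + 1 < a \<or> i = a - 1" "j < b \<or> j = b" "k < a \<or> k = a" by linarith+
    then show ?thesis unfolding card using middle a b s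
      by (elim disjE) (auto simp: of_nat_diff algebra_simps)
  next
    case (top k)
    then show ?thesis unfolding card using a b s by (cases "k = a") (auto simp: of_nat_diff algebra_simps)
  qed
qed

text \<open>Potentials telescope to zero along a closed run, so only its length and its two counts
  survive.\<close>

lemma sums_over_run:
  assumes "run s n p v s" "s \<in> states"
  shows "2 * (\<Sum>t<n. int (card (ideal_of ((step ^^ t) s)))) =
      int n * (2 * int a + int b - 1) + (int a + int b) * (int p - int v)"
    and "int a * int b * (\<Sum>t<n. int (card (frontier ((step ^^ t) s)))) =
      int n * (2 * int b * (int a - 1) + int a * (int b - 1)) + (int a + int b - int a * int b) * (int p + int v)"
proof -
  have st: "(step ^^ t) s \<in> states" for t
    by (induction t) (use assms(2) step_in_states in auto)
  have tel: "(\<Sum>t<n. K (step ((step ^^ t) s)) - K ((step ^^ t) s)) = 0" for K :: "_ \<Rightarrow> int"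
    using sum_lessThan_telescope[of "\<lambda>t. K ((step ^^ t) s)" n] run_imp_sums(1)[OF assms(1)] by simp
  have p: "(\<Sum>t<n. int (peaks ((step ^^ t) s))) = int p" and v: "(\<Sum>t<n. int (valleys ((step ^^ t) s))) = int v"
    using run_imp_sums(2,3)[OF assms(1)] by (simp_all flip: of_nat_sum)
  have pv: "(\<Sum>t<n. int (peaks ((step ^^ t) s)) - int (valleys ((step ^^ t) s))) = int p - int v"
    by (simp add: sum_subtractf p v)
  have "2 * (\<Sum>t<n. int (card (ideal_of ((step ^^ t) s)))) = (\<Sum>t<n. 2 * int a + int b - 1
     + (ideal_potential (step ((step ^^ t) s)) - ideal_potential ((step ^^ t) s))
     + (int a + int b) * (int (peaks ((step ^^ t) s)) - int (valleys ((step ^^ t) s))))"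
    unfolding sum_distrib_left by (intro sum.cong refl card_ideal_of st)
  also have "\<dots> = int n * (2 * int a + int b - 1) + (int a + int b) * (int p - int v)"
    by (simp only: sum.distrib tel sum_distrib_left[symmetric] pv) simp
  finally show "2 * (\<Sum>t<n. int (card (ideal_of ((step ^^ t) s)))) =
      int n * (2 * int a + int b - 1) + (int a + int b) * (int p - int v)" .
  have "int a * int b * (\<Sum>t<n. int (card (frontier ((step ^^ t) s)))) =
     (\<Sum>t<n. 2 * int b * (int a - 1) + int a * (int b - 1)
     + (antichain_potential (step ((step ^^ t) s)) - antichain_potential ((step ^^ t) s))
     + (int a + int b - int a * int b) * (int (peaks ((step ^^ t) s)) + int (valleys ((step ^^ t) s))))"
    unfolding sum_distrib_left by (intro sum.cong refl card_frontier st)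
  also have "\<dots> = int n * (2 * int b * (int a - 1) + int a * (int b - 1)) + (int a + int b - int a * int b) * (int p + int v)"
    by (simp only: sum.distrib tel sum_distrib_left[symmetric] p v) (simp add: algebra_simps)
  finally show "int a * int b * (\<Sum>t<n. int (card (frontier ((step ^^ t) s)))) =
      int n * (2 * int b * (int a - 1) + int a * (int b - 1)) + (int a + int b - int a * int b) * (int p + int v)" .
qed

end

section \<open>Returns to the cross\<close>

text \<open>The bound \<open>q \<le> a'\<close> carries what the minimality of \<open>m\<close>
  contributes.\<close>

locale fence_arithmetic = fence_parameters +
  fixes g a' b' q m :: nat
  assumes a_eq: "a = g * a'" and b_eq: "b = g * b'" and coprime: "coprime a' b'"
    and q_inverse: "m * a' = q * b' + 1" and q_bounds: "0 < q" "q \<le> a'"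
begin

lemma pos: "0 < g" "0 < a'" "0 < b'"
  using a b a_eq b_eq by (auto intro: Nat.gr0I)

text \<open>Since \<open>q b' \<equiv> -1\<close> modulo \<open>a'\<close>, the point at height \<open>g c\<close> on one axis reaches the other axis
  after exactly \<open>residue c\<close> translations by \<open>(b, b)\<close>.\<close>

definition residue :: "nat \<Rightarrow> nat" where
  "residue c = (q * c) mod a'"

text \<open>The passage from \<open>a - 1\<close> to \<open>-(a - 1)\<close> first gains the peak and then loses the valley. The
  extra point \<open>-a\<close>, a state outside the torus, splits it in two, so that all blocks have the same
  shape.\<close>

definition cross :: "int \<Rightarrow> nat \<times> nat \<times> nat" where
  "cross j = (if j = - int a then (a, b + 1, a) else torus (min j 0) (max j 0))"

lemma coprime_q: "coprime a' q"
proof (rule coprimeI)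
  fix d assume "d dvd a'" "d dvd q"
  then have "d dvd q * b' + 1" by (metis q_inverse dvd_mult)
  moreover have "d dvd q * b'" using \<open>d dvd q\<close> by simp
  ultimately show "is_unit d" using dvd_add_right_iff[of d "q * b'" 1] by blast
qed

section \<open>Divisibility by \<open>a\<close> along translations\<close>

lemma dvd_shift_iff: "int a dvd int s * b \<longleftrightarrow> a' dvd s"
proof -
  have "int a dvd int s * b \<longleftrightarrow> a dvd s * b" by (metis of_nat_dvd_iff of_nat_mult)
  also have "\<dots> \<longleftrightarrow> a' dvd s * b'" using pos by (simp add: a_eq b_eq mult.left_commute)
  also have "\<dots> \<longleftrightarrow> a' dvd s" using coprime by (simp add: coprime_dvd_mult_left_iff)
  finally show ?thesis .
qed

text \<open>Dividing by \<open>g\<close> and multiplying by \<open>q\<close>, a unit modulo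
  \<open>a'\<close>, turns the divisibility into a congruence solved for \<open>s\<close>, because
  \<open>q * b'\<close> is \<open>-1\<close> modulo \<open>a'\<close>.\<close>

lemma dvd_shift_add_iff: "int a dvd int g * c + int s * b \<longleftrightarrow> int a' dvd int q * c - int s"
proof -
  have qb: "int q * int b' = int m * int a' - 1"
    using arg_cong[OF q_inverse, of int] by simp
  have "int a dvd int g * c + int s * b \<longleftrightarrow> int g * int a' dvd int g * (c + int s * int b')"
    by (simp add: a_eq b_eq algebra_simps)
  also have "\<dots> \<longleftrightarrow> int a' dvd c + int s * int b'" using pos by simp
  also have "\<dots> \<longleftrightarrow> int a' dvd int q * (c + int s * int b')"
    using coprime_q by (simp add: coprime_dvd_mult_right_iff)
  also have "int q * (c + int s * int b') = (int q * c - int s) + int a' * (int m * int s)"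
    using qb by (simp add: algebra_simps)
      (metis (no_types, opaque_lifting) add.commute diff_add_cancel distrib_left mult.commute mult.left_commute mult_1)
  finally show ?thesis by (metis dvd_add_times_triv_right_iff mult.commute)
qed

text \<open>Translation by \<open>b\<close> preserves the residue modulo \<open>g\<close>, so a
  coordinate not divisible by \<open>g\<close> never reaches \<open>0\<close> modulo
  \<open>a\<close>.\<close>

lemma not_dvd_shift_add:
  assumes "\<not> int g dvd x"
  shows "\<not> int a dvd x + int s * b"
proof
  assume "int a dvd x + int s * b"
  then have "int g dvd x + int s * b" by (metis a_eq dvd_mult_left of_nat_mult)
  moreover have "int g dvd int s * b" by (simp add: b_eq)
  ultimately show False using assms by (simp add: dvd_add_left_iff)
qed

text \<open>The exceptional passage moves the point one place along the axis and already includes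
  one translation. So \<open>h\<close> translations take \<open>h * b + 1\<close> steps, and only
  the times strictly between \<open>0\<close> and \<open>h\<close> have to miss the axes.\<close>

lemma run_cross_up:
  assumes "0 \<le> j" "j + 1 < int a" "0 < h"
    and "\<And>s. 0 < s \<Longrightarrow> s < h \<Longrightarrow> \<not> int a dvd int s * b \<and> \<not> int a dvd j + 1 + int s * b"
  shows "run (cross j) (h * b + 1) 1 0 (torus (int h * b) (j + 1 + int h * b))"
proof -
  have "cross j = torus 0 j" using assms a by (simp add: cross_def)
  moreover have "(j + 1) mod int a \<noteq> 0" using assms by simp
  ultimately have "run (cross j) (b + 1) 1 0 (torus b (j + 1 + b))" using run_upper_axis by simp
  moreover have "run (torus b (j + 1 + b)) ((h - 1) * b) 0 0
      (torus (int b + int (h - 1) * b) (j + 1 + int b + int (h - 1) * b))"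
  proof (rule run_free)
    fix s assume "s < h - 1"
    then show "(int b + int s * b) mod int a \<noteq> 0 \<and> (j + 1 + int b + int s * b) mod int a \<noteq> 0"
      using assms(4)[of "s + 1"] by (simp add: dvd_eq_mod_eq_0 algebra_simps)
  qed
  moreover have "int b + int (h - 1) * b = int h * b" "b + (h - 1) * b = h * b"
    using \<open>0 < h\<close> by (cases h; simp add: algebra_simps)+
  ultimately show ?thesis
    using run_trans[of "cross j" "b + 1" 1 0 "torus b (j + 1 + b)" "(h - 1) * b" 0 0] by (simp add: add.assoc)
qed

lemma run_cross_down:
  assumes "- int a \<le> j" "j < 0" "0 < h"
    and "\<And>s. 0 < s \<Longrightarrow> s < h \<Longrightarrow> \<not> int a dvd int s * b \<and> \<not> int a dvd j + 1 + int s * b"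
  shows "run (cross j) (h * b + 1) 0 1 (torus (j + 1 + int h * b) (int h * b))"
proof -
  have "run (cross j) (b + 1) 0 1 (torus (j + 1 + b) b)"
  proof (cases "j = - int a")
    case True
    \<comment> \<open>The extra point \<open>- a\<close> is the full ideal. As
      \<open>- a + 1\<close> and \<open>1\<close> agree modulo \<open>a\<close>, it continues like
      any other point of this arm.\<close>
    then have "torus (1 + b) b = torus (j + 1 + b) b" by (intro torus_cong) (simp_all add: mod_eq_dvd_iff)
    then show ?thesis using run_from_corner True by (simp add: cross_def)
  next
    case False
    then have "cross j = torus j 0" using assms by (simp add: cross_def)
    moreover have "j mod int a \<noteq> 0"
      using zdvd_imp_le[of "int a" "- j"] assms False by (auto simp: mod_eq_0_iff_dvd)
    ultimately show ?thesis using run_lower_axis by simp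
  qed
  moreover have "run (torus (j + 1 + b) b) ((h - 1) * b) 0 0
      (torus (j + 1 + int b + int (h - 1) * b) (int b + int (h - 1) * b))"
  proof (rule run_free)
    fix s assume "s < h - 1"
    then show "(j + 1 + int b + int s * b) mod int a \<noteq> 0 \<and> (int b + int s * b) mod int a \<noteq> 0"
      using assms(4)[of "s + 1"] by (simp add: dvd_eq_mod_eq_0 algebra_simps)
  qed
  moreover have "int b + int (h - 1) * b = int h * b" "b + (h - 1) * b = h * b"
    using \<open>0 < h\<close> by (cases h; simp add: algebra_simps)+
  ultimately show ?thesis
    using run_trans[of "cross j" "b + 1" 0 1 "torus (j + 1 + b) b" "(h - 1) * b" 0 0] by (simp add: add.assoc)
qed

section \<open>The first return map of the cross\<close>

lemma not_dvd_shift: "0 < s \<Longrightarrow> s < a' \<Longrightarrow> \<not> int a dvd int s * b"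
  unfolding dvd_shift_iff by (auto dest: dvd_imp_le)

lemma full_shift: "(x + int a' * b) mod int a = x mod int a"
proof -
  have "int a' * b = int b' * int a" by (simp add: a_eq b_eq)
  then show ?thesis by simp
qed

text \<open>When \<open>g\<close> does not divide \<open>j + 1\<close> the other axis is never met,
  and the same axis returns only after \<open>a'\<close> translations, the order of \<open>b\<close>
  modulo \<open>a\<close>.\<close>

lemma run_stay_up:
  assumes "0 \<le> j" "j + 1 < int a" "\<not> int g dvd j + 1"
  shows "run (cross j) (a' * b + 1) 1 0 (cross (j + 1))"
proof -
  have "torus (int a' * b) (j + 1 + int a' * b) = cross (j + 1)"
    using assms full_shift[of 0] full_shift[of "j + 1"]
    by (auto simp: cross_def intro!: torus_cong)
  then show ?thesis
    using run_cross_up[OF assms(1,2) pos(2)] not_dvd_shift not_dvd_shift_add[OF assms(3)] by simp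
qed

lemma run_stay_down:
  assumes "- int a \<le> j" "j < 0" "\<not> int g dvd j + 1"
  shows "run (cross j) (a' * b + 1) 0 1 (cross (j + 1))"
proof -
  have "torus (j + 1 + int a' * b) (int a' * b) = cross (j + 1)"
    using assms full_shift[of 0] full_shift[of "j + 1"]
    by (auto simp: cross_def intro!: torus_cong)
  then show ?thesis
    using run_cross_down[OF assms(1,2) pos(2)] not_dvd_shift not_dvd_shift_add[OF assms(3)] by simp
qed

lemma dvd_add_residue: "int a dvd int g * int c + int (residue c) * b"
proof -
  have "int (residue c) = int q * int c mod int a'" by (simp add: residue_def zmod_int)
  then show ?thesis unfolding dvd_shift_add_iff by (simp add: mod_eq_dvd_iff[symmetric])
qed

lemma residue_less: "residue c < a'"
  using pos by (simp add: residue_def)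

lemma residue_unique:
  assumes "s < a'" "int a dvd int g * int c + int s * b"
  shows "s = residue c"
proof -
  have "int q * int c mod int a' = int s mod int a'"
    using assms(2) unfolding dvd_shift_add_iff by (simp add: mod_eq_dvd_iff)
  then have "residue c = s mod a'"
    unfolding residue_def by (metis of_nat_eq_iff of_nat_mult zmod_int)
  then show ?thesis using assms(1) by simp
qed

text \<open>The shift brings the point to \<open>g * c\<close> on the axis \<open>u = 0\<close>. The
  first translation that makes \<open>w\<close> vanish is number \<open>residue c\<close>, by
  \<open>residue_unique\<close>, and then \<open>u\<close> is \<open>- g * c\<close> modulo
  \<open>a\<close>: the point has changed axis.\<close>

lemma run_flip_up:
  assumes "1 \<le> c" "c \<le> a'"
  shows "run (cross (int (g * c) - 1)) (residue c * b + 1) 1 0 (cross (- int (g * c)))"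
proof (cases "c = a'")
  case True
  \<comment> \<open>Here the residue is \<open>0\<close>: a single step reaches the full ideal,
    which is the point \<open>- a\<close>.\<close>
  then show ?thesis using run_corner a by (simp add: cross_def a_eq[symmetric] residue_def)
next
  case False
  have "\<not> a' dvd q * c"
    using coprime_q assms False by (auto simp: coprime_dvd_mult_right_iff dest: dvd_imp_le)
  then have r: "0 < residue c" by (simp add: residue_def mod_greater_zero_iff_not_dvd)
  have le: "int (g * c) < int a" "0 < g * c" "g * c \<noteq> a"
    using assms False pos by (auto simp: a_eq)
  have eq: "torus (int (residue c) * b) (int (g * c) + int (residue c) * b) = cross (- int (g * c))"
  proof -
    have "(int (residue c) * b) mod int a = (- int (g * c)) mod int a"
      using dvd_add_residue[of c] by (simp add: mod_eq_dvd_iff algebra_simps)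
    moreover have "(int (g * c) + int (residue c) * b) mod int a = 0"
      using dvd_add_residue[of c] by (simp add: dvd_eq_mod_eq_0)
    ultimately show ?thesis using le by (auto simp: cross_def intro!: torus_cong)
  qed
  have "run (cross (int (g * c) - 1)) (residue c * b + 1) 1 0
      (torus (int (residue c) * b) (int (g * c) - 1 + 1 + int (residue c) * b))"
  proof (rule run_cross_up)
    fix s assume s: "0 < s" "s < residue c"
    then have "s < a'" using residue_less[of c] by simp
    then show "\<not> int a dvd int s * b \<and> \<not> int a dvd int (g * c) - 1 + 1 + int s * b"
      using not_dvd_shift residue_unique[of s c] s by auto
  qed (use le r in auto)
  then show ?thesis using eq by simp
qed

text \<open>As \<open>residue c\<close> translations lead from \<open>g * c\<close> to
  \<open>0\<close>, the remaining \<open>a' - residue c\<close> of a full period lead from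
  \<open>- g * c\<close> to \<open>0\<close>. For \<open>c = 0\<close> this is a full period, ending
  at the origin.\<close>

lemma run_flip_down:
  assumes "c < a'"
  shows "run (cross (- int (g * c) - 1)) ((a' - residue c) * b + 1) 0 1 (cross (int (g * c)))"
proof -
  define h where "h = a' - residue c"
  have h: "0 < h" "h \<le> a'" "int h = int a' - int (residue c)"
    using residue_less[of c] by (auto simp: h_def)
  have le: "int (g * c) < int a" "int a \<noteq> - int (g * c)"
    using assms pos a by (auto simp: a_eq simp flip: of_nat_mult)
  have dvd: "int a dvd - int (g * c) + int h * b"
  proof -
    have "- int (g * c) + int h * b = int a' * b - (int g * int c + int (residue c) * b)"
      by (simp add: h algebra_simps)
    moreover have "int a dvd int a' * b" by (simp add: a_eq b_eq)
    ultimately show ?thesis using dvd_add_residue[of c] by (simp only: dvd_diff)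
  qed
  have eq: "torus (- int (g * c) + int h * b) (int h * b) = cross (int (g * c))"
  proof -
    have "(int h * b) mod int a = int (g * c) mod int a"
      using dvd by (simp add: mod_eq_dvd_iff algebra_simps)
    moreover have "(- int (g * c) + int h * b) mod int a = 0" using dvd by (simp add: dvd_eq_mod_eq_0)
    ultimately show ?thesis using le a by (auto simp: cross_def intro!: torus_cong)
  qed
  have "run (cross (- int (g * c) - 1)) (h * b + 1) 0 1
      (torus (- int (g * c) - 1 + 1 + int h * b) (int h * b))"
  proof (rule run_cross_down)
    fix s assume s: "0 < s" "s < h"
    \<comment> \<open>Two times at which \<open>u\<close> vanishes differ by a multiple of
      \<open>a'\<close>, and \<open>s\<close> and \<open>h\<close> are too close for that.\<close>
    have "\<not> int a dvd - int (g * c) + int s * b"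
    proof
      assume "int a dvd - int (g * c) + int s * b"
      moreover have "(- int (g * c) + int h * b) - (- int (g * c) + int s * b) = int (h - s) * b"
        using s by (simp add: of_nat_diff algebra_simps)
      ultimately have "int a dvd int (h - s) * b" using dvd by (metis dvd_diff)
      moreover have "0 < h - s" "h - s < a'" using s h by linarith+
      ultimately show False using not_dvd_shift by blast
    qed
    then show "\<not> int a dvd int s * b \<and> \<not> int a dvd - int (g * c) - 1 + 1 + int s * b"
      using not_dvd_shift s h by simp
  qed (use le h in \<open>auto simp del: of_nat_mult\<close>)
  then show ?thesis using eq by (simp add: h_def)
qed

section \<open>Closed runs through the blocks and their reflections\<close>

lemma not_dvd_between: "0 < r \<Longrightarrow> r < g \<Longrightarrow> \<not> int g dvd int g * x + int r"
  by (auto simp: dvd_add_right_iff dest: dvd_imp_le)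

lemma run_block_up:
  assumes "c < a'" "i + r < g"
  shows "run (cross (int (g * c + i))) (r * (a' * b + 1)) r 0 (cross (int (g * c + i + r)))"
  using assms(2)
proof (induction r)
  case 0 then show ?case by (simp add: run_refl)
next
  case (Suc r)
  have "g * c + i + Suc r < g * (c + 1)" using Suc.prems by (simp add: algebra_simps)
  also have "\<dots> \<le> a" unfolding a_eq using assms(1) by (intro mult_left_mono) auto
  finally have "int (g * c + i + r) + 1 < int a" by linarith
  moreover have "\<not> int g dvd int (g * c + i + r) + 1"
    using Suc.prems not_dvd_between[of "i + r + 1" "int c"] by (simp add: algebra_simps)
  ultimately have "run (cross (int (g * c + i + r))) (a' * b + 1) 1 0 (cross (int (g * c + i + r) + 1))"
    by (intro run_stay_up) simp
  from run_trans[OF Suc.IH this] Suc.prems show ?case by (simp add: algebra_simps)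
qed

lemma run_block_down:
  assumes "c < a'" "i + r < g"
  shows "run (cross (int i - int (g * (c + 1)))) (r * (a' * b + 1)) 0 r (cross (int (i + r) - int (g * (c + 1))))"
  using assms(2)
proof (induction r)
  case 0 then show ?case by (simp add: run_refl)
next
  case (Suc r)
  have le: "g * (c + 1) \<le> a" unfolding a_eq using assms(1) by (intro mult_left_mono) auto
  have "i + r < g * (c + 1)" using Suc.prems by simp
  then have "- int a \<le> int (i + r) - int (g * (c + 1))" "int (i + r) - int (g * (c + 1)) < 0"
    using le by linarith+
  moreover have "\<not> int g dvd int (i + r) - int (g * (c + 1)) + 1"
    using Suc.prems not_dvd_between[of "i + r + 1" "- int (c + 1)"] by (simp add: algebra_simps)
  ultimately have "run (cross (int (i + r) - int (g * (c + 1)))) (a' * b + 1) 0 1 (cross (int (i + r) - int (g * (c + 1)) + 1))"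
    by (rule run_stay_down)
  from run_trans[OF Suc.IH this] Suc.prems show ?case by (simp add: algebra_simps)
qed

lemma run_block_up_end:
  assumes "c < a'" "i < g"
  shows "run (cross (int (g * c + i))) ((g - 1 - i) * (a' * b + 1)) (g - 1 - i) 0 (cross (int (g * (c + 1)) - 1))"
proof -
  have eq: "int (g * c + i + (g - 1 - i)) = int (g * (c + 1)) - 1"
    using assms by (simp add: of_nat_diff algebra_simps)
  have "i + (g - 1 - i) < g" using assms by simp
  from run_block_up[OF assms(1) this] show ?thesis unfolding eq .
qed

lemma run_block_down_end:
  assumes "c < a'" "i < g"
  shows "run (cross (int i - int (g * (c + 1)))) ((g - 1 - i) * (a' * b + 1)) 0 (g - 1 - i) (cross (- int (g * c) - 1))"
proof -
  have eq: "int (i + (g - 1 - i)) - int (g * (c + 1)) = - int (g * c) - 1"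
    using assms by (simp add: of_nat_diff algebra_simps)
  have "i + (g - 1 - i) < g" using assms by simp
  from run_block_down[OF assms(1) this] show ?thesis unfolding eq .
qed

text \<open>Made up of \<open>2 * (g - 1)\<close> passages of length \<open>a' * b + 1\<close>
  within the block and its reflection, and two changes of axis, of lengths
  \<open>residue (c + 1) * b + 1\<close> and \<open>(a' - residue c) * b + 1\<close>.\<close>

definition block_period :: "nat \<Rightarrow> nat" where
  "block_period c = b * (2 * (g - 1) * a' + (a' + residue (c + 1) - residue c)) + 2 * g"

text \<open>Up the block, across to its reflection, through it, and back: \<open>g\<close> passages
  start on each arm of the cross, giving the peaks on one and the valleys on the other.\<close>

lemma run_block:
  assumes "c < a'"
  shows "run (cross (int (g * c))) (block_period c) g g (cross (int (g * c)))"
proof -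
  have "run (cross (int (g * c))) ((g - 1) * (a' * b + 1)) (g - 1) 0 (cross (int (g * (c + 1)) - 1))"
    using run_block_up_end[OF assms pos(1)] by simp
  moreover have "run (cross (int (g * (c + 1)) - 1)) (residue (c + 1) * b + 1) 1 0 (cross (- int (g * (c + 1))))"
    using run_flip_up[of "c + 1"] assms by simp
  moreover have "run (cross (- int (g * (c + 1)))) ((g - 1) * (a' * b + 1)) 0 (g - 1) (cross (- int (g * c) - 1))"
    using run_block_down_end[OF assms pos(1)] by simp
  ultimately have "run (cross (int (g * c)))
     ((g - 1) * (a' * b + 1) + (residue (c + 1) * b + 1) + (g - 1) * (a' * b + 1) + ((a' - residue c) * b + 1))
     (g - 1 + 1 + 0 + 0) (0 + 0 + (g - 1) + 1) (cross (int (g * c)))"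
    using run_flip_down[OF assms] by (intro run_trans)
  moreover have "(g - 1) * (a' * b + 1) + (residue (c + 1) * b + 1) + (g - 1) * (a' * b + 1) + ((a' - residue c) * b + 1)
    = block_period c"
  proof -
    define d where "d = a' - residue c"
    have "a' + residue (c + 1) - residue c = residue (c + 1) + d"
      using residue_less[of c] by (simp add: d_def)
    moreover obtain g' where "g = Suc g'" using pos(1) gr0_conv_Suc by blast
    ultimately show ?thesis unfolding block_period_def d_def[symmetric] by (simp add: algebra_simps)
  qed
  ultimately show ?thesis using pos by simp
qed

lemma reaches_block:
  assumes "- int a < j" "j < int a"
  shows "\<exists>c<a'. reaches (cross j) (cross (int (g * c)))"
proof (cases "0 \<le> j")
  case True
  define c i where "c = nat j div g" and "i = nat j mod g"
  have c: "c < a'" using True assms pos by (simp add: c_def a_eq div_less_iff_less_mult mult.commute nat_less_iff)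
  have i: "i < g" using pos by (simp add: i_def)
  have j: "j = int (g * c + i)" using True by (simp add: c_def i_def)
  have "reaches (cross j) (cross (int (g * (c + 1)) - 1))"
    unfolding j by (rule run_imp_reaches[OF run_block_up_end[OF c i]])
  moreover have "reaches (cross (int (g * (c + 1)) - 1)) (cross (- int (g * (c + 1))))"
    using run_flip_up[of "c + 1"] c by (intro run_imp_reaches) simp
  moreover have "reaches (cross (- int (g * (c + 1)))) (cross (- int (g * c) - 1))"
    using run_imp_reaches[OF run_block_down_end[OF c pos(1)]] by simp
  moreover have "reaches (cross (- int (g * c) - 1)) (cross (int (g * c)))"
    using run_flip_down[OF c] by (rule run_imp_reaches)
  ultimately show ?thesis using c reaches_trans by blast
next
  case False
  \<comment> \<open>The reflected block of \<open>c\<close> consists of the \<open>j\<close> with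
    \<open>- g * (c + 1) \<le> j < - g * c\<close>, hence the passage to \<open>- j - 1\<close>
    before dividing.\<close>
  define c i where "c = nat (- j - 1) div g" and "i = g - 1 - nat (- j - 1) mod g"
  have c: "c < a'" using False assms pos by (simp add: c_def a_eq div_less_iff_less_mult mult.commute nat_less_iff)
  have i: "i < g" using pos by (simp add: i_def)
  have "nat (- j - 1) mod g < g" using pos by simp
  moreover have "- j - 1 = int (g * c + nat (- j - 1) mod g)" using False by (simp add: c_def)
  ultimately have j: "j = int i - int (g * (c + 1))" by (simp add: i_def of_nat_diff algebra_simps)
  have "reaches (cross j) (cross (- int (g * c) - 1))"
    unfolding j by (rule run_imp_reaches[OF run_block_down_end[OF c i]])
  moreover have "reaches (cross (- int (g * c) - 1)) (cross (int (g * c)))"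
    using run_flip_down[OF c] by (rule run_imp_reaches)
  ultimately show ?thesis using c reaches_trans by blast
qed

section \<open>Translation cycles missing the cross\<close>

lemma run_small:
  assumes "\<not> int g dvd u" "\<not> int g dvd w"
  shows "run (torus u w) (t * b) 0 0 (torus (u + int t * b) (w + int t * b))"
proof (rule run_free)
  fix s
  show "(u + int s * b) mod int a \<noteq> 0 \<and> (w + int s * b) mod int a \<noteq> 0"
    using not_dvd_shift_add[OF assms(1)] not_dvd_shift_add[OF assms(2)] by (simp add: dvd_eq_mod_eq_0)
qed

lemma run_small_period:
  assumes "\<not> int g dvd u" "\<not> int g dvd w"
  shows "run (torus u w) (a' * b) 0 0 (torus u w)"
proof -
  have "torus (u + int a' * b) (w + int a' * b) = torus u w" by (intro torus_cong full_shift)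
  then show ?thesis using run_small[OF assms, of a'] by simp
qed

text \<open>A translation cycle visits every value of \<open>u\<close> in its class modulo
  \<open>g\<close> exactly once, so \<open>u\<close> may be taken in \<open>1..<g\<close>, while
  \<open>w\<close> ranges freely over the nonmultiples of \<open>g\<close>.\<close>

definition small_reps :: "(nat \<times> nat) set" where
  "small_reps = {1..<g} \<times> {w. w < a \<and> \<not> g dvd w}"

lemma reaches_small:
  assumes "\<not> int g dvd u" "\<not> int g dvd w"
  shows "\<exists>(x, y)\<in>small_reps. reaches (torus u w) (torus (int x) (int y))"
proof -
  define c where "c = u div int g"
  obtain t :: nat where t: "int a dvd int g * c + int t * b"
  proof -
    have "int a' dvd int q * c - int (nat (int q * c mod int a'))" using pos by (simp add: mod_eq_dvd_iff[symmetric])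
    then show ?thesis using that unfolding dvd_shift_add_iff by blast
  qed
  define x y where "x = nat (u mod int g)" and "y = nat ((w + int t * b) mod int a)"
  have x: "int x = u mod int g" and y: "int y = (w + int t * b) mod int a"
    using pos a by (simp_all add: x_def y_def)
  have "torus (u + int t * b) (w + int t * b) = torus (int x) (int y)"
  proof (rule torus_cong)
    \<comment> \<open>By the choice of \<open>t\<close> the part \<open>g * c\<close> of
      \<open>u\<close> is cancelled modulo \<open>a\<close>, leaving the remainder of
      \<open>u\<close> modulo \<open>g\<close>.\<close>
    have "u + int t * b = (int g * c + int t * b) + int x" by (simp add: c_def x)
    then have "int a dvd (u + int t * b) - int x" using t by (metis add_diff_cancel_right')
    then show "(u + int t * b) mod int a = int x mod int a" by (simp add: mod_eq_dvd_iff)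
  qed (simp add: y)
  moreover have "(x, y) \<in> small_reps"
  proof -
    have "x < g" using pos by (simp add: x_def nat_less_iff)
    moreover have "x \<noteq> 0" using assms(1) x by (intro notI) (simp add: dvd_eq_mod_eq_0)
    moreover have "y < a" using a by (simp add: y_def nat_less_iff)
    moreover have "\<not> g dvd y"
    proof
      assume "g dvd y"
      then have "int g dvd (w + int t * b) mod int a" by (simp flip: y)
      then have "int g dvd w + int t * b" by (simp add: a_eq dvd_mod_iff)
      moreover have "int g dvd int t * b" by (simp add: b_eq)
      ultimately show False using assms(2) by (simp add: dvd_add_left_iff)
    qed
    ultimately show ?thesis by (simp add: small_reps_def)
  qed
  ultimately show ?thesis using run_imp_reaches[OF run_small[OF assms, of t]] by auto
qed

lemma reaches_cross:
  assumes "int g dvd u \<or> int g dvd w"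
  shows "\<exists>j. - int a < j \<and> j < int a \<and> reaches (torus u w) (cross j)"
proof -
  define hit where "hit t \<longleftrightarrow> int a dvd u + int t * b \<or> int a dvd w + int t * b" for t :: nat
  have "\<exists>t::nat. int a dvd x + int t * b" if "int g dvd x" for x
  proof -
    from that obtain c where x: "x = int g * c" by (elim dvdE)
    have "int a' dvd int q * c - int (nat (int q * c mod int a'))" using pos by (simp add: mod_eq_dvd_iff[symmetric])
    then show ?thesis unfolding x dvd_shift_add_iff by blast
  qed
  then have ex: "\<exists>t. hit t" using assms by (auto simp: hit_def)
  \<comment> \<open>Before the first time an axis is met, all moves are plain translations.\<close>
  define t where "t = (LEAST t. hit t)"
  have t: "hit t" unfolding t_def using ex by (rule LeastI_ex)
  have "run (torus u w) (t * b) 0 0 (torus (u + int t * b) (w + int t * b))"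
  proof (rule run_free)
    fix s assume "s < t"
    then have "\<not> hit s" unfolding t_def by (rule not_less_Least)
    then show "(u + int s * b) mod int a \<noteq> 0 \<and> (w + int s * b) mod int a \<noteq> 0"
      by (simp add: hit_def dvd_eq_mod_eq_0)
  qed
  then have r: "reaches (torus u w) (torus (u + int t * b) (w + int t * b))" by (rule run_imp_reaches)
  have a0: "0 < int a" using a by simp
  show ?thesis
  proof (cases "int a dvd u + int t * b")
    case True
    define j where "j = (w + int t * b) mod int a"
    have j: "0 \<le> j" "j < int a" using a0 by (simp_all add: j_def)
    then have "cross j = torus 0 j" using a by (simp add: cross_def)
    also have "\<dots> = torus (u + int t * b) (w + int t * b)"
      using True by (intro torus_cong) (simp_all add: j_def dvd_eq_mod_eq_0)
    finally show ?thesis using r j by (intro exI[of _ j]) simp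
  next
    case False
    then have w: "int a dvd w + int t * b" using t by (simp add: hit_def)
    \<comment> \<open>Points of the axis \<open>w = 0\<close> carry the negative numbers; the origin
      belongs to the other case.\<close>
    define j where "j = (u + int t * b) mod int a - int a"
    have "(u + int t * b) mod int a \<noteq> 0" using False by (simp add: dvd_eq_mod_eq_0)
    moreover have "0 \<le> (u + int t * b) mod int a" "(u + int t * b) mod int a < int a" using a0 by simp_all
    ultimately have j: "- int a < j" "j < 0" by (simp_all add: j_def)
    then have "cross j = torus j 0" by (simp add: cross_def)
    also have "\<dots> = torus (u + int t * b) (w + int t * b)"
      using w by (intro torus_cong) (simp_all add: j_def dvd_eq_mod_eq_0)
    finally show ?thesis using r j by (intro exI[of _ j]) simp
  qed
qed

section \<open>The orbits\<close>

definition reps :: "((nat \<times> nat) + nat) set" where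
  "reps = small_reps <+> {..<a'}"

fun rep :: "(nat \<times> nat) + nat \<Rightarrow> nat \<times> nat \<times> nat" where
  "rep (Inl (x, y)) = torus (int x) (int y)"
| "rep (Inr c) = cross (int (g * c))"

fun period :: "(nat \<times> nat) + nat \<Rightarrow> nat" where
  "period (Inl _) = a' * b"
| "period (Inr c) = block_period c"

text \<open>One number serves for both counts, because the closed run of a representative has as
  many peaks as valleys.\<close>

fun defects :: "(nat \<times> nat) + nat \<Rightarrow> nat" where
  "defects (Inl _) = 0"
| "defects (Inr _) = g"

lemma run_rep: "j \<in> reps \<Longrightarrow> run (rep j) (period j) (defects j) (defects j) (rep j)"
proof (cases j rule: rep.cases)
  case (1 x y)
  assume "j \<in> reps"
  then have "0 < x" "x < g" "\<not> g dvd y" by (auto simp: 1 reps_def small_reps_def)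
  then have "\<not> int g dvd int x" "\<not> int g dvd int y" by (auto dest: dvd_imp_le)
  then show ?thesis using run_small_period by (simp add: 1)
next
  case (2 c)
  assume "j \<in> reps"
  then have "c < a'" by (auto simp: 2 reps_def)
  then show ?thesis using run_block by (simp add: 2)
qed

lemma period_pos: "j \<in> reps \<Longrightarrow> 0 < period j"
  using pos b by (cases j) (auto simp: block_period_def)

lemma cross_in_states: "cross j \<in> states"
  using a by (simp add: cross_def torus_in_states states_iff)

lemma rep_in_states: "rep j \<in> states"
  by (cases j rule: rep.cases) (simp_all add: torus_in_states cross_in_states)

lemma card_small_reps: "card small_reps = a' * (g - 1)\<^sup>2"
proof -
  have "{w. w < a \<and> \<not> g dvd w} = {..<a} - (*) g ` {..<a'}"
    using pos by (auto simp: a_eq image_iff elim!: dvdE)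
  moreover have "card ((*) g ` {..<a'}) = a'" using pos by (subst card_image) (auto simp: inj_on_def)
  moreover have "(*) g ` {..<a'} \<subseteq> {..<a}" using pos by (auto simp: a_eq)
  ultimately have "card {w. w < a \<and> \<not> g dvd w} = a - a'" by (simp add: card_Diff_subset)
  then have "card small_reps = (g - 1) * (a - a')" by (simp add: small_reps_def card_cartesian_product)
  also have "a - a' = a' * (g - 1)" by (simp add: a_eq algebra_simps)
  finally show ?thesis by (simp add: power2_eq_square)
qed

lemma finite_reps: "finite reps"
  by (simp add: reps_def small_reps_def)

text \<open>The residues telescope over the blocks, since \<open>residue 0\<close> and
  \<open>residue a'\<close> both vanish. What remains is
  \<open>a'^2 * b * ((g - 1) + 1)^2 + 2 * a\<close>, the number of states.\<close>

lemma sum_period: "sum period reps = card states"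
proof -
  have fin: "finite small_reps" by (simp add: small_reps_def)
  have "int (block_period c) = (int b * (2 * (int g - 1) * int a' + int a') + 2 * int g)
      + (int b * int (residue (c + 1)) - int b * int (residue c))" for c
  proof -
    have "int (a' + residue (c + 1) - residue c) = int a' + int (residue (c + 1)) - int (residue c)"
      "int (g - 1) = int g - 1"
      using residue_less[of c] pos by simp_all
    then show ?thesis
      by (simp only: block_period_def of_nat_add of_nat_mult of_nat_numeral) (simp add: algebra_simps)
  qed
  then have "(\<Sum>c<a'. int (block_period c)) = int a' * (int b * (2 * (int g - 1) * int a' + int a') + 2 * int g)
      + (\<Sum>c<a'. int b * int (residue (Suc c)) - int b * int (residue c))"
    by (simp add: sum.distrib)
  also have "(\<Sum>c<a'. int b * int (residue (Suc c)) - int b * int (residue c)) = 0"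
    by (subst sum_lessThan_telescope) (simp add: residue_def)
  finally have block: "(\<Sum>c<a'. int (block_period c)) = int a' * (int b * (2 * (int g - 1) * int a' + int a') + 2 * int g)"
    by simp
  have "sum period reps = card small_reps * (a' * b) + (\<Sum>c<a'. block_period c)"
    unfolding reps_def using fin by (simp add: sum.Plus)
  then have "int (sum period reps) = int a' * (int g - 1)\<^sup>2 * (int a' * int b) + (\<Sum>c<a'. int (block_period c))"
    using pos by (simp add: card_small_reps of_nat_diff)
  also have "\<dots> = int (card states)"
    unfolding block card_states by (simp add: a_eq power2_eq_square algebra_simps)
  finally show ?thesis by linarith
qed

lemma reaches_rep:
  assumes "s \<in> states"
  shows "\<exists>j\<in>reps. \<exists>t. (step ^^ t) s = rep j"
proof -
  obtain u w where s: "reaches s (torus u w)" using reaches_torus[OF assms] by blast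
  have "\<exists>j\<in>reps. reaches (torus u w) (rep j)"
  proof (cases "int g dvd u \<or> int g dvd w")
    case True
    then obtain j where "- int a < j" "j < int a" "reaches (torus u w) (cross j)"
      using reaches_cross by blast
    then obtain c where "c < a'" "reaches (torus u w) (cross (int (g * c)))"
      using reaches_block reaches_trans by blast
    then show ?thesis by (intro bexI[of _ "Inr c"]) (auto simp: reps_def)
  next
    case False
    then obtain x y where "(x, y) \<in> small_reps" "reaches (torus u w) (torus (int x) (int y))"
      using reaches_small by blast
    then show ?thesis by (intro bexI[of _ "Inl (x, y)"]) (auto simp: reps_def)
  qed
  then show ?thesis using s reaches_trans unfolding reaches_def[symmetric] by blast
qed

lemma bij_betw_reps: "bij_betw (\<lambda>(j, t). (step ^^ t) (rep j)) (SIGMA j:reps. {..<period j}) states"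
proof (rule bij_betw_periodic_cover[OF finite_states finite_reps])
  show "inj_on step states" using bij_betw_step by (simp add: bij_betw_def)
qed (use step_in_states rep_in_states run_imp_sums(1)[OF run_rep] period_pos reaches_rep sum_period in blast)+

lemma step_period: "j \<in> reps \<Longrightarrow> (step ^^ period j) (rep j) = rep j"
  using run_imp_sums(1)[OF run_rep] .

lemma orbits_step: "orbit step ` states = (\<lambda>j. orbit step (rep j)) ` reps"
  by (intro orbits_periodic_cover[OF bij_betw_reps] step_period period_pos)

lemma inj_on_orbits_step: "inj_on (\<lambda>j. orbit step (rep j)) reps"
  by (rule orbits_periodic_cover[OF bij_betw_reps]; intro step_period period_pos; assumption)

lemma sum_orbit:
  fixes h :: "_ \<Rightarrow> 'c::comm_monoid_add"
  assumes "j \<in> reps"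
  shows "sum h (orbit step (rep j)) = (\<Sum>t<period j. h ((step ^^ t) (rep j)))"
  by (intro orbits_periodic_cover[OF bij_betw_reps] step_period period_pos assms)

text \<open>Used with \<open>e\<close> the encoding by ideals or by antichains and \<open>f\<close>
  the matching rowmotion: \<open>e\<close> conjugates \<open>step\<close> to \<open>f\<close>, so
  orbits, lengths and sums carry over.\<close>

lemma
  assumes "inj_on e states" and "\<forall>s\<in>states. f (e s) = e (step s)"
  shows orbits_encoding: "orbit f ` e ` states = (\<lambda>j. e ` orbit step (rep j)) ` reps"
    and inj_on_orbits_encoding: "inj_on (\<lambda>j. e ` orbit step (rep j)) reps"
    and sum_orbit_encoding: "\<And>(h :: _ \<Rightarrow> 'c::comm_monoid_add) j. j \<in> reps \<Longrightarrow> sum h (e ` orbit step (rep j)) =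
      (\<Sum>t<period j. h (e ((step ^^ t) (rep j))))"
    and card_orbit_encoding: "\<And>j. j \<in> reps \<Longrightarrow> card (e ` orbit step (rep j)) = period j"
proof -
  have sub: "orbit step s \<subseteq> states" if "s \<in> states" for s
  proof
    fix t assume "t \<in> orbit step s"
    then show "t \<in> states" by induction (use that step_in_states in auto)
  qed
  have "orbit f (e s) = e ` orbit step s" if "s \<in> states" for s
    by (rule orbit_conjugate[of states]) (use step_in_states assms(2) that in auto)
  then have "orbit f ` e ` states = (`) e ` orbit step ` states"
    unfolding image_image by (intro image_cong refl)
  also have "\<dots> = (\<lambda>j. e ` orbit step (rep j)) ` reps"
    unfolding orbits_step by (simp add: image_image)
  finally show "orbit f ` e ` states = (\<lambda>j. e ` orbit step (rep j)) ` reps" .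
  show "inj_on (\<lambda>j. e ` orbit step (rep j)) reps"
    using inj_on_orbits_step sub[OF rep_in_states] assms(1) unfolding inj_on_def[of _ reps]
    by (metis inj_on_image_eq_iff)
  have inj: "inj_on e (orbit step (rep j))" for j
    using sub[OF rep_in_states] assms(1) by (blast intro: inj_on_subset)
  show "sum h (e ` orbit step (rep j)) = (\<Sum>t<period j. h (e ((step ^^ t) (rep j))))"
    if "j \<in> reps" for h :: "_ \<Rightarrow> 'c" and j
    using sum_orbit[OF that, of "h \<circ> e"] by (simp add: sum.reindex[OF inj])
  show "card (e ` orbit step (rep j)) = period j" if "j \<in> reps" for j
    using sum_orbit[OF that, of "\<lambda>_. 1 :: nat"] by (simp add: card_image[OF inj])
qed

section \<open>Medium and large blocks\<close>

definition medium_reps :: "((nat \<times> nat) + nat) set" where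
  "medium_reps = Inr ` {c. c < a' \<and> a' \<le> residue c + q}"

definition large_reps :: "((nat \<times> nat) + nat) set" where
  "large_reps = Inr ` {c. c < a' \<and> residue c + q < a'}"

lemma reps_partition:
  "reps = Inl ` small_reps \<union> medium_reps \<union> large_reps"
  "Inl ` small_reps \<inter> medium_reps = {}" "Inl ` small_reps \<inter> large_reps = {}" "medium_reps \<inter> large_reps = {}"
  by (auto simp: reps_def medium_reps_def large_reps_def image_iff)

text \<open>As \<open>q \<le> a'\<close>, adding \<open>q\<close> wraps at most once. The blocks
  where it wraps are the medium ones, and there the two changes of axis together take
  \<open>q\<close> translations; in the large ones they take \<open>a' + q\<close>.\<close>

lemma residue_Suc: "residue (c + 1) = (if residue c + q < a' then residue c + q else residue c + q - a')"
proof -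
  have "residue (c + 1) = (residue c + q) mod a'"
    by (simp add: residue_def mod_add_left_eq mod_simps algebra_simps)
  then show ?thesis using residue_less[of c] q_bounds
    by (auto simp: mod_if le_mod_geq)
qed

lemma bij_betw_residue: "bij_betw residue {..<a'} {..<a'}"
proof -
  have "inj_on residue {..<a'}"
  proof (rule inj_onI)
    fix c d assume cd: "c \<in> {..<a'}" "d \<in> {..<a'}" "residue c = residue d"
    have "int a' dvd int q * (int c - int d)"
      using arg_cong[OF cd(3), of int] by (simp add: residue_def zmod_int mod_eq_dvd_iff algebra_simps)
    then have "int a' dvd int c - int d" using coprime_q by (simp add: coprime_dvd_mult_right_iff)
    then have "int c mod int a' = int d mod int a'" by (simp add: mod_eq_dvd_iff)
    then show "c = d" using cd by simp
  qed
  moreover have "residue ` {..<a'} \<subseteq> {..<a'}" using residue_less by auto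
  ultimately show ?thesis by (simp add: bij_betw_def endo_inj_surj)
qed

text \<open>Multiplication by the unit \<open>q\<close> permutes \<open>{..<a'}\<close>, so the
  medium blocks correspond to the \<open>q\<close> largest residues.\<close>

lemma card_medium_reps: "card medium_reps = q"
proof -
  have "residue ` {c. c < a' \<and> a' \<le> residue c + q} = {r \<in> residue ` {..<a'}. a' \<le> r + q}" by auto
  also have "residue ` {..<a'} = {..<a'}" using bij_betw_residue by (simp add: bij_betw_def)
  also have "{r \<in> {..<a'}. a' \<le> r + q} = {a' - q..<a'}" by auto
  finally have "residue ` {c. c < a' \<and> a' \<le> residue c + q} = {a' - q..<a'}" .
  moreover have "inj_on residue {c. c < a' \<and> a' \<le> residue c + q}"
    using bij_betw_residue by (auto simp: bij_betw_def inj_on_def)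
  ultimately have "card {c. c < a' \<and> a' \<le> residue c + q} = q"
    using q_bounds card_image by fastforce
  then show ?thesis by (simp add: medium_reps_def card_image)
qed

lemma card_large_reps: "card large_reps = a' - q"
proof -
  have "card {c. c < a' \<and> residue c + q < a'} = card ({..<a'} - {c. c < a' \<and> a' \<le> residue c + q})"
    by (intro arg_cong[where f = card]) auto
  also have "\<dots> = a' - q"
    using card_medium_reps by (subst card_Diff_subset) (auto simp: medium_reps_def card_image)
  finally show ?thesis by (simp add: large_reps_def card_image)
qed

lemma period_small: "j \<in> Inl ` small_reps \<Longrightarrow> period j = lcm a b"
proof -
  have "lcm a b = g * lcm a' b'" by (simp add: a_eq b_eq lcm_mult_left)
  also have "\<dots> = a' * b" using coprime by (simp add: b_eq lcm_coprime)
  finally show "j \<in> Inl ` small_reps \<Longrightarrow> period j = lcm a b" by auto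
qed

lemma period_medium:
  assumes "j \<in> medium_reps"
  shows "period j = b * (2 * (g - 1) * a' + q) + 2 * g"
  using assms residue_Suc residue_less q_bounds by (auto simp: medium_reps_def block_period_def)

lemma period_large:
  assumes "j \<in> large_reps"
  shows "period j = b * (2 * (g - 1) * a' + (a' + q)) + 2 * g"
  using assms residue_Suc residue_less by (auto simp: large_reps_def block_period_def)

text \<open>Multiplying \<open>m * a' = q * b' + 1\<close> by \<open>g\<close> gives
  \<open>a * m = b * q + g\<close>, which trades \<open>m\<close> for \<open>q\<close>.\<close>

lemma medium_length: "a * (2 * b - 2 * b' + m) + g = b * (2 * (g - 1) * a' + q) + 2 * g"
proof -
  have "2 * b - 2 * b' = 2 * (g - 1) * b'" by (simp add: b_eq algebra_simps)
  moreover have "a * m = b * q + g"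
    using arg_cong[OF q_inverse, of "\<lambda>x. g * x"] by (simp add: a_eq b_eq algebra_simps)
  moreover have "a * (2 * (g - 1) * b') = b * (2 * (g - 1) * a')" by (simp add: a_eq b_eq)
  ultimately show ?thesis by (simp only: add_mult_distrib2 ac_simps)
qed

lemma large_length: "a * (2 * b - b' + m) + g = b * (2 * (g - 1) * a' + (a' + q)) + 2 * g"
proof -
  have "2 * b - b' = 2 * b - 2 * b' + b'" using pos by (simp add: b_eq)
  then have "a * (2 * b - b' + m) + g = (a * (2 * b - 2 * b' + m) + g) + a * b'"
    by (simp only: add_mult_distrib2 ac_simps)
  also have "a * b' = b * a'" by (simp add: a_eq b_eq)
  finally show ?thesis unfolding medium_length by (simp only: add_mult_distrib2 ac_simps)
qed

text \<open>Medium and large periods differ by \<open>a' * b\<close>. A small representative exists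
  only if \<open>g \<ge> 2\<close>; then the term \<open>2 * (g - 1) * a' * b\<close> alone is at
  least \<open>a' * b\<close>, and \<open>2 * g\<close> makes the inequality strict.\<close>

lemma period_separates:
  assumes "i \<in> reps" "j \<in> reps" "period i = period j"
  shows "(i \<in> Inl ` small_reps \<longleftrightarrow> j \<in> Inl ` small_reps) \<and> (i \<in> medium_reps \<longleftrightarrow> j \<in> medium_reps) \<and>
    (i \<in> large_reps \<longleftrightarrow> j \<in> large_reps)"
proof -
  have "period i \<noteq> period j" if "i \<in> medium_reps" "j \<in> large_reps" for i j
    using b pos by (simp add: period_medium[OF that(1)] period_large[OF that(2)])
  moreover have "period i < period j" if "i \<in> Inl ` small_reps" "j \<in> medium_reps \<union> large_reps" for i j
  proof -
    have "1 \<le> g - 1" using that(1) by (auto simp: small_reps_def)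
    then have "a' \<le> 2 * (g - 1) * a'" by simp
    then have "a' * b \<le> b * (2 * (g - 1) * a')" by (simp add: mult.commute)
    moreover have "period i = a' * b" using that(1) by auto
    moreover have "b * (2 * (g - 1) * a') + 2 * g \<le> period j"
      using that(2) period_medium[of j] period_large[of j] by (auto simp: add_mult_distrib2)
    ultimately show ?thesis using pos(1) by linarith
  qed
  ultimately show ?thesis
    using assms unfolding reps_partition(1) by (metis (no_types, lifting) UnE UnI1 UnI2 less_irrefl)
qed

lemma defects_eq:
  assumes "i \<in> reps" "j \<in> reps" "period i = period j"
  shows "defects i = defects j"
  using period_separates[OF assms] assms(1,2) by (cases i; cases j) (auto simp: reps_def)

lemma orbit_partition:
  assumes "inj_on e states" and "\<forall>s\<in>states. f (e s) = e (step s)"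
  defines "Os \<equiv> orbit f ` e ` states"
  shows "\<exists>S M L.
          S \<union> M \<union> L = Os \<and> S \<inter> M = {} \<and> S \<inter> L = {} \<and> M \<inter> L = {} \<and>
          (\<forall>X\<in>Os. \<forall>Y\<in>Os. card X = card Y \<longrightarrow>
             (X \<in> S \<longleftrightarrow> Y \<in> S) \<and> (X \<in> M \<longleftrightarrow> Y \<in> M) \<and> (X \<in> L \<longleftrightarrow> Y \<in> L)) \<and>
          card S = a' * (g - 1)\<^sup>2 \<and> card M = q \<and> int (card L) = int a' - int q \<and>
          (\<forall>X\<in>S. card X = lcm a b) \<and>
          (\<forall>X\<in>M. card X = a * (2 * b - 2 * b' + m) + g) \<and>
          (\<forall>X\<in>L. card X = a * (2 * b - b' + m) + g)"
proof -
  define orb where "orb j = e ` orbit step (rep j)" for j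
  have Os: "Os = orb ` reps" and inj: "inj_on orb reps" and card: "\<And>j. j \<in> reps \<Longrightarrow> card (orb j) = period j"
    unfolding Os_def orb_def
    using orbits_encoding[OF assms(1,2)] inj_on_orbits_encoding[OF assms(1,2)] card_orbit_encoding[OF assms(1,2)]
    by blast+
  have mem: "orb j \<in> orb ` K \<longleftrightarrow> j \<in> K" if "K \<subseteq> reps" "j \<in> reps" for K j
    using inj that by (auto dest: inj_onD)
  have sub: "Inl ` small_reps \<subseteq> reps" "medium_reps \<subseteq> reps" "large_reps \<subseteq> reps"
    using reps_partition(1) by auto
  have disj: "orb ` A \<inter> orb ` B = {}" if "A \<subseteq> reps" "B \<subseteq> reps" "A \<inter> B = {}" for A B
    using inj_on_image_Int[OF inj that(1,2)] that(3) by simp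
  have card': "card (orb ` A) = card A" if "A \<subseteq> reps" for A
    using inj_on_subset[OF inj that] by (rule card_image)
  have length: "\<forall>X\<in>orb ` K. card X = N" if "K \<subseteq> reps" "\<And>j. j \<in> K \<Longrightarrow> period j = N" for K N
    using card that by auto
  show ?thesis
  proof (intro exI conjI)
    show "orb ` Inl ` small_reps \<union> orb ` medium_reps \<union> orb ` large_reps = Os"
      unfolding Os reps_partition(1) by blast
    show "\<forall>X\<in>Os. \<forall>Y\<in>Os. card X = card Y \<longrightarrow>
        (X \<in> orb ` Inl ` small_reps \<longleftrightarrow> Y \<in> orb ` Inl ` small_reps) \<and>
        (X \<in> orb ` medium_reps \<longleftrightarrow> Y \<in> orb ` medium_reps) \<and>
        (X \<in> orb ` large_reps \<longleftrightarrow> Y \<in> orb ` large_reps)"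
    proof (intro ballI impI)
      fix X Y assume "X \<in> Os" "Y \<in> Os" and eq: "card X = card Y"
      then obtain i j where ij: "i \<in> reps" "X = orb i" "j \<in> reps" "Y = orb j" by (auto simp: Os)
      then have "period i = period j" using eq card by simp
      from period_separates[OF ij(1,3) this]
      show "(X \<in> orb ` Inl ` small_reps \<longleftrightarrow> Y \<in> orb ` Inl ` small_reps) \<and>
        (X \<in> orb ` medium_reps \<longleftrightarrow> Y \<in> orb ` medium_reps) \<and>
        (X \<in> orb ` large_reps \<longleftrightarrow> Y \<in> orb ` large_reps)"
        unfolding ij(2,4) using mem[OF sub(1)] mem[OF sub(2)] mem[OF sub(3)] ij(1,3) by simp
    qed
    show "card (orb ` Inl ` small_reps) = a' * (g - 1)\<^sup>2"
      unfolding card'[OF sub(1)] by (simp add: card_image card_small_reps)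
    show "card (orb ` medium_reps) = q"
      unfolding card'[OF sub(2)] by (rule card_medium_reps)
    show "int (card (orb ` large_reps)) = int a' - int q"
      unfolding card'[OF sub(3)] using card_large_reps q_bounds by simp
    show "\<forall>X\<in>orb ` Inl ` small_reps. card X = lcm a b"
      by (rule length[OF sub(1) period_small])
    show "\<forall>X\<in>orb ` medium_reps. card X = a * (2 * b - 2 * b' + m) + g"
      unfolding medium_length by (rule length[OF sub(2) period_medium])
    show "\<forall>X\<in>orb ` large_reps. card X = a * (2 * b - b' + m) + g"
      unfolding large_length by (rule length[OF sub(3) period_large])
  qed (use disj sub reps_partition in blast)+
qed

section \<open>The two statistics on orbits\<close>

lemma antichain_orbits_eq: "antichain_orbits (fence a b) (fence_order a b)
    = orbit (antichain_rowmotion (fence a b) (fence_order a b)) ` frontier ` states"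
  unfolding antichain_orbits_def frontier_states ..

lemma ideal_orbits_eq: "ideal_orbits (fence a b) (fence_order a b)
    = orbit (ideal_rowmotion (fence a b) (fence_order a b)) ` ideal_of ` states"
  unfolding ideal_orbits_def ideal_of_states ..

text \<open>The sum over an orbit depends only on its length and on \<open>defects\<close>, and the
  length determines the class of the orbit and with it \<open>defects\<close>.\<close>

lemma homometric_antichains:
  "homometric (\<lambda>A. real (card A)) (antichain_orbits (fence a b) (fence_order a b))"
  unfolding homometric_def
proof (intro ballI impI)
  note enc = inj_on_frontier antichain_rowmotion_frontier
  fix X Y assume "X \<in> antichain_orbits (fence a b) (fence_order a b)"
    "Y \<in> antichain_orbits (fence a b) (fence_order a b)" and eq: "card X = card Y"
  then obtain i j where ij: "i \<in> reps" "j \<in> reps"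
    and X: "X = frontier ` orbit step (rep i)" and Y: "Y = frontier ` orbit step (rep j)"
    unfolding antichain_orbits_eq orbits_encoding[OF enc] by blast
  have period: "period i = period j" using eq card_orbit_encoding[OF enc] ij by (simp add: X Y)
  then have defects: "defects i = defects j" using defects_eq ij by blast
  have sum: "int a * int b * (\<Sum>A\<in>frontier ` orbit step (rep j). int (card A)) =
      int (period j) * (2 * int b * (int a - 1) + int a * (int b - 1))
      + (int a + int b - int a * int b) * (int (defects j) + int (defects j))" if "j \<in> reps" for j
    unfolding sum_orbit_encoding[OF enc that] by (rule sums_over_run(2)[OF run_rep[OF that] rep_in_states])
  have "int a * int b * (\<Sum>A\<in>X. int (card A)) = int a * int b * (\<Sum>A\<in>Y. int (card A))"
    unfolding X Y sum[OF ij(1)] sum[OF ij(2)] period defects ..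
  then have "(\<Sum>A\<in>X. int (card A)) = (\<Sum>A\<in>Y. int (card A))" using a b by simp
  then show "(\<Sum>A\<in>X. real (card A)) = (\<Sum>A\<in>Y. real (card A))"
    by (simp flip: of_nat_sum)
qed

text \<open>Peaks and valleys are equally many on every closed run of a representative, so the
  correction to the mean size cancels.\<close>

lemma mesic_ideals:
  "mesic (real (2 * a + b - 1) / 2) (\<lambda>I. real (card I)) (ideal_orbits (fence a b) (fence_order a b))"
  unfolding mesic_def
proof
  note enc = inj_on_ideal_of ideal_rowmotion_ideal_of
  fix X assume "X \<in> ideal_orbits (fence a b) (fence_order a b)"
  then obtain j where j: "j \<in> reps" and X: "X = ideal_of ` orbit step (rep j)"
    unfolding ideal_orbits_eq orbits_encoding[OF enc] by blast
  have card: "card X = period j" unfolding X using enc j by (rule card_orbit_encoding)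
  have "int (2 * (\<Sum>I\<in>X. card I)) = 2 * (\<Sum>I\<in>X. int (card I))" by simp
  also have "\<dots> = int (period j) * (2 * int a + int b - 1)"
    unfolding X sum_orbit_encoding[OF enc j] sums_over_run(1)[OF run_rep[OF j] rep_in_states] by simp
  also have "\<dots> = int (period j * (2 * a + b - 1))" using a by (simp add: of_nat_diff)
  finally have "2 * (\<Sum>I\<in>X. card I) = period j * (2 * a + b - 1)"
    by (simp only: of_nat_eq_iff)
  then have "real (2 * (\<Sum>I\<in>X. card I)) = real (period j * (2 * a + b - 1))" by (rule arg_cong)
  then have "2 * (\<Sum>I\<in>X. real (card I)) = real (period j) * real (2 * a + b - 1)"
    by (simp only: of_nat_mult of_nat_sum of_nat_numeral)
  then show "(\<Sum>I\<in>X. real (card I)) / real (card X) = real (2 * a + b - 1) / 2"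
    using period_pos[OF j] by (simp add: card field_simps)
qed

end

section \<open>Existence of \<open>m\<close>, the bound on \<open>q\<close>, and the
  conclusion\<close>

theorem theorem4p4:
  fixes a b g a' b' l m n :: nat
  assumes "a \<ge> 2" and "b \<ge> 1"
    and "g = gcd a b" and "a' = a div g" and "b' = b div g" and "l = lcm a b"
    and "m = (LEAST k. k > 0 \<and> (\<exists>q>0. k * a' = q * b' + 1))"
    and "n = card (fence a b)"
  shows "n = 2 * a + b - 1 \<and>
    (\<exists>q>0. m * a' = q * b' + 1 \<and>
      (\<forall>Os \<in> {antichain_orbits (fence a b) (fence_order a b),
               ideal_orbits (fence a b) (fence_order a b)}.
        \<exists>S M L.
          S \<union> M \<union> L = Os \<and> S \<inter> M = {} \<and> S \<inter> L = {} \<and> M \<inter> L = {} \<and>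
          (\<forall>X\<in>Os. \<forall>Y\<in>Os. card X = card Y \<longrightarrow>
             (X \<in> S \<longleftrightarrow> Y \<in> S) \<and> (X \<in> M \<longleftrightarrow> Y \<in> M) \<and> (X \<in> L \<longleftrightarrow> Y \<in> L)) \<and>
          card S = a' * (g - 1)\<^sup>2 \<and> card M = q \<and> int (card L) = int a' - int q \<and>
          (\<forall>X\<in>S. card X = l) \<and>
          (\<forall>X\<in>M. card X = a * (2 * b - 2 * b' + m) + g) \<and>
          (\<forall>X\<in>L. card X = a * (2 * b - b' + m) + g))) \<and>
    homometric (\<lambda>A. real (card A)) (antichain_orbits (fence a b) (fence_order a b)) \<and>
    mesic (real n / 2) (\<lambda>I. real (card I)) (ideal_orbits (fence a b) (fence_order a b))"
proof -
  have ab: "a = g * a'" "b = g * b'" and cop: "coprime a' b'" and pos: "0 < a'" "0 < b'"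
    using assms(1-5) div_gcd_coprime[of a b] by (auto simp: div_greater_zero_iff gcd_le1_nat gcd_le2_nat)
  let ?P = "\<lambda>k. k > 0 \<and> (\<exists>q>0. k * a' = q * b' + 1)"
  obtain x y where "a' * x = b' * y + gcd a' b'" using bezout_nat[of a' b'] pos by auto
  \<comment> \<open>Adding \<open>b'\<close> and \<open>a'\<close> to the Bezout coefficients keeps
    the equation and makes both positive.\<close>
  then have "(x + b') * a' = (y + a') * b' + 1" using cop by (simp add: algebra_simps)
  then have "?P (x + b')" using pos by (intro conjI exI[of _ "y + a'"]) auto
  then have "?P m" unfolding assms(7) by (rule LeastI)
  then obtain q where q: "0 < q" "m * a' = q * b' + 1" by blast
  \<comment> \<open>Otherwise \<open>(m - b', q - a')\<close> would be a smaller positive solution,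
    against the choice of \<open>m\<close>.\<close>
  have "q \<le> a'"
  proof (rule ccontr)
    assume "\<not> q \<le> a'"
    then have q': "q = q - a' + a'" by simp
    have "b' < m"
    proof (rule ccontr)
      assume "\<not> b' < m"
      then have "m * a' \<le> b' * q" using \<open>\<not> q \<le> a'\<close> by (intro mult_mono) auto
      then show False using q(2) by (simp add: mult.commute)
    qed
    then have "((m - b') + b') * a' = ((q - a') + a') * b' + 1" using q(2) q' by simp
    then have "(m - b') * a' + b' * a' = (q - a') * b' + a' * b' + 1" by (simp only: add_mult_distrib)
    then have "(m - b') * a' = (q - a') * b' + 1" using mult.commute[of b' a'] by linarith
    moreover have "0 < m - b'" "0 < q - a'" using \<open>b' < m\<close> \<open>\<not> q \<le> a'\<close> by simp_all
    ultimately have "?P (m - b')" by blast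
    then have "(LEAST k. ?P k) \<le> m - b'" by (rule Least_le)
    then have "m \<le> m - b'" by (simp only: assms(7))
    then show False using pos \<open>b' < m\<close> by simp
  qed
  interpret fence_arithmetic a b g a' b' q m
    by unfold_locales (use assms(1,2) ab cop q \<open>q \<le> a'\<close> in auto)
  have n: "n = 2 * a + b - 1" by (simp add: assms(8) fence_def)
  have orbits: "\<forall>Os \<in> {antichain_orbits (fence a b) (fence_order a b), ideal_orbits (fence a b) (fence_order a b)}.
      \<exists>S M L.
          S \<union> M \<union> L = Os \<and> S \<inter> M = {} \<and> S \<inter> L = {} \<and> M \<inter> L = {} \<and>
          (\<forall>X\<in>Os. \<forall>Y\<in>Os. card X = card Y \<longrightarrow>
             (X \<in> S \<longleftrightarrow> Y \<in> S) \<and> (X \<in> M \<longleftrightarrow> Y \<in> M) \<and> (X \<in> L \<longleftrightarrow> Y \<in> L)) \<and>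
          card S = a' * (g - 1)\<^sup>2 \<and> card M = q \<and> int (card L) = int a' - int q \<and>
          (\<forall>X\<in>S. card X = l) \<and>
          (\<forall>X\<in>M. card X = a * (2 * b - 2 * b' + m) + g) \<and>
          (\<forall>X\<in>L. card X = a * (2 * b - b' + m) + g)"
    (is "\<forall>Os \<in> _. ?partition Os")
  proof
    fix Os assume "Os \<in> {antichain_orbits (fence a b) (fence_order a b), ideal_orbits (fence a b) (fence_order a b)}"
    then consider "Os = antichain_orbits (fence a b) (fence_order a b)"
      | "Os = ideal_orbits (fence a b) (fence_order a b)" by blast
    then obtain e f where Os: "Os = orbit f ` e ` states" and "inj_on e states"
      "\<forall>s\<in>states. f (e s) = e (step s)"
    proof cases
      case 1
      show ?thesis
        using that[OF _ inj_on_frontier antichain_rowmotion_frontier] by (simp only: 1 antichain_orbits_eq)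
    next
      case 2
      show ?thesis
        using that[OF _ inj_on_ideal_of ideal_rowmotion_ideal_of] by (simp only: 2 ideal_orbits_eq)
    qed
    then show "?partition Os" unfolding Os assms(6) by (intro orbit_partition)
  qed
  show ?thesis
    by (intro conjI exI[of _ q]) (fact n q orbits homometric_antichains | use mesic_ideals n in simp)+
qed

end
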